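(* There is a model $\mathcal{M}$ of the theory $\Sigma^1_1\text{-}\mathsf{LB}+\mathsf{GC}$ such that the structure $(\mathrm{wfExt}(\mathcal{M}),\eta)$ satisfies all the axioms of $\mathsf{ZFC}\text{-}\mathsf{P}$ (with $\eta$ interpreting membership).
   Context: **Language.** The language is many-sorted: one sort of objects and, for each $n\ge 1$, a sort of $n$-ary concepts (a $1$-ary concept is just called a concept). It has: predication $R(a_1,\dots,a_n)$; for all $m,n>0$ a function symbol $(R,a_1,\dots,a_n)\mapsto R[a_1,\dots,a_n]$ taking an $(n+m)$-ary concept and $n$ objects to the $m$-ary concept $\{(y_1,\dots,y_m): R(a_1,\dots,a_n,y_1,\dots,y_m)\}$; and a function symbol $\partial$ from unary concepts to objects. Models have the form $\mathcal{M}=(M,S_1(M),S_2(M),\dots,\partial)$ with $M\neq\emptyset$, $S_n(M)\subseteq P(M^n)$ (Henkin semantics: $S_n(M)$ need not be the full power set) and $\partial:S_1(M)\to M$. Identity of concepts is extensional. Concept quantifiers are called second-order. A $\Sigma^1_1$-formula is a block of existential concept quantifiers followed by a formula with no second-order quantifiers. **Axioms.** *Basic Law V*: $\forall X,Y\,(\partial(X)=\partial(Y)\leftrightarrow X=Y)$. *First-Order Comprehension Schema*: $\exists R\,\forall\overline a\,(R\overline a\leftrightarrow\varphi(\overline a))$ for every $\varphi(\overline x)$ without second-order quantifiers, possibly with object and concept parameters, with $R$ not free in $\varphi$. *$\Sigma^1_1$-Choice Schema*: $[\forall\overline x\,\exists R'\,\varphi(\overline x,R')]\rightarrow\exists R\,\forall\overline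 x\,\varphi(\overline x,R[\overline x])$ for every $\Sigma^1_1$-formula $\varphi(\overline x,R')$, possibly with parameters, where $\overline x$ is an $n$-tuple of object variables, $R'$ is $m$-ary, $R$ is $(n+m)$-ary and not free in $\varphi$ ($n,m\ge1$). The theory $\Sigma^1_1\text{-}\mathsf{LB}$ consists of Basic Law V, the First-Order Comprehension Schema and the $\Sigma^1_1$-Choice Schema, in the signature just described (including $\partial$ and the maps $R[\overline a]$). The theory $\Sigma^1_1\text{-}\mathsf{LB}+\mathsf{GC}$ expands the signature by a binary relation symbol $<$ on objects (allowed in the schemata), and adds axioms saying that $<$ is a linear order of the objects, together with the schema $[\exists x\,\varphi(x)]\to[\exists x\,(\varphi(x)\wedge\forall y<x\,\neg\varphi(y))]$ for all formulas $\varphi(x)$ of the expanded signature ($x$ an object variable), possibly with parameters. **Defined notions** (all interpreted in the model). Membership: $a\,\eta\,b\iff\exists B\,(\partial(B)=b\wedge Ba)$. An extension is an object in $\mathrm{rng}(\partial)$. $a\subseteq_\eta b\iff\forall c\,(c\,\eta\,a\to c\,\eta\,b)$. For an extension $x=\partial(F)$, $\sigma(x)=\partial(G)$ where $Gz\leftrightarrow(Fz\vee z=x)$. A concept $F$ is $\eta$-transitive if $Fx$ and $y\,\eta\,x$ imply $Fy$. $(\mathrm{Trcl}_\eta(x))(y)$ holds iff for every concept $F$ which is $\eta$-transitive and satisfies $x\subseteq_\eta\partial(F)$ one has $Fy$. For a definable class $\mathcal X$ of objects, "$(\mathcal X,\eta)$ is well-founded" means that every non-empty concept $F$ all of whose elements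 are in $\mathcal X$ has an element $y$ such that no $z$ with $Fz$ satisfies $z\,\eta\,y$. Finally $\mathrm{wfExt}(x)$ says: $x$ is an extension, $(\mathrm{Trcl}_\eta(\sigma(x)),\eta)$ is well-founded, and every object in $\mathrm{Trcl}_\eta(\sigma(x))$ is in $\mathrm{rng}(\partial)$; and $\mathrm{wfExt}(\mathcal M)=\{x\in M:\mathcal M\models\mathrm{wfExt}(x)\}$. **Set theory.** $\mathsf{ZFC}\text{-}\mathsf{P}$ is the theory consisting of extensionality, pairing, union, infinity, the separation schema, the collection schema, foundation, and the statement that every set can be well-ordered (no power set axiom). The collection schema is $\forall\overline p\,[\forall x\,\exists y\,\varphi(x,y,\overline p)]\to[\forall u\,\exists v\,\forall x\in u\,\exists y\in v\,\varphi(x,y,\overline p)]$. *)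

theory Defs
  imports Main
begin

section \<open>Structures\<close>

text \<open>
  An \<open>n\<close>-tuple is a list of length \<open>n\<close>, and an \<open>n\<close>-ary concept is a set of such tuples; in
  particular a unary concept \<open>F\<close> holds of \<open>a\<close> iff \<open>[a] \<in> F\<close>. Concepts being sets, their identity
  is extensional. Only the sorts \<open>Conc M n\<close> with \<open>n \<ge> 1\<close> matter.
\<close>

record 'a henkin_structure =
  Obj :: "'a set"
  Conc :: "nat \<Rightarrow> 'a list set set"
  ext :: "'a list set \<Rightarrow> 'a"
  less_obj :: "'a \<Rightarrow> 'a \<Rightarrow> bool"

definition tuples :: "'a set \<Rightarrow> nat \<Rightarrow> 'a list set" where
  "tuples A n = {as. length as = n \<and> set as \<subseteq> A}"

text \<open>The concept \<open>R[a\<^sub>1,\<dots>,a\<^sub>n]\<close>.\<close>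

definition section_at :: "'a list set \<Rightarrow> 'a list \<Rightarrow> 'a list set" where
  "section_at R as = {ys. as @ ys \<in> R}"

text \<open>
  Nonemptiness of the concept sorts is the usual convention of many-sorted logic. It follows from
  comprehension, but is needed here so that the quantification over total assignments in
  the schemata below is never vacuous. The closure condition says that the function
  symbols \<open>R[a\<^sub>1,\<dots>,a\<^sub>n]\<close> are interpreted by total functions.
\<close>

definition is_henkin_structure :: "'a henkin_structure \<Rightarrow> bool" where
  "is_henkin_structure M \<longleftrightarrow>
     Obj M \<noteq> {} \<and>
     (\<forall>n\<ge>1. Conc M n \<subseteq> Pow (tuples (Obj M) n) \<and> Conc M n \<noteq> {}) \<and>
     (\<forall>F\<in>Conc M 1. ext M F \<in> Obj M) \<and>
     (\<forall>n\<ge>1. \<forall>m\<ge>1. \<forall>R\<in>Conc M (n + m). \<forall>as\<in>tuples (Obj M) n. section_at R as \<in> Conc M m)"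


section \<open>Formulas\<close>

text \<open>
  \<open>OVar i\<close> is the \<open>i\<close>-th object variable, \<open>CVar n i\<close> the \<open>i\<close>-th variable for \<open>n\<close>-ary concepts.
\<close>

datatype oterm = OVar nat | Ext cterm
  and cterm = CVar nat nat | Sect cterm "oterm list"

datatype form =
    EqO oterm oterm
  | EqC cterm cterm
  | Less oterm oterm
  | Pred cterm "oterm list"
  | Neg form
  | Conj form form
  | ExO nat form
  | ExC nat nat form

fun arity :: "cterm \<Rightarrow> nat" where
  "arity (CVar n i) = n"
| "arity (Sect R ts) = arity R - length ts"

fun wf_oterm :: "oterm \<Rightarrow> bool" and wf_cterm :: "cterm \<Rightarrow> bool" where
  "wf_oterm (OVar i) = True"
| "wf_oterm (Ext R) = (wf_cterm R \<and> arity R = 1)"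
| "wf_cterm (CVar n i) = (n \<ge> 1)"
| "wf_cterm (Sect R ts) =
     (wf_cterm R \<and> (\<forall>t\<in>set ts. wf_oterm t) \<and> 1 \<le> length ts \<and> length ts < arity R)"

fun wf_form :: "form \<Rightarrow> bool" where
  "wf_form (EqO s t) = (wf_oterm s \<and> wf_oterm t)"
| "wf_form (EqC R S) = (wf_cterm R \<and> wf_cterm S \<and> arity R = arity S)"
| "wf_form (Less s t) = (wf_oterm s \<and> wf_oterm t)"
| "wf_form (Pred R ts) = (wf_cterm R \<and> (\<forall>t\<in>set ts. wf_oterm t) \<and> length ts = arity R)"
| "wf_form (Neg p) = wf_form p"
| "wf_form (Conj p q) = (wf_form p \<and> wf_form q)"
| "wf_form (ExO i p) = wf_form p"
| "wf_form (ExC n i p) = (n \<ge> 1 \<and> wf_form p)"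

fun first_order :: "form \<Rightarrow> bool" where
  "first_order (Neg p) = first_order p"
| "first_order (Conj p q) = (first_order p \<and> first_order q)"
| "first_order (ExO i p) = first_order p"
| "first_order (ExC n i p) = False"
| "first_order _ = True"

inductive sigma11 :: "form \<Rightarrow> bool" where
  "first_order p \<Longrightarrow> sigma11 p"
| "sigma11 p \<Longrightarrow> sigma11 (ExC n i p)"


section \<open>Henkin semantics\<close>

type_synonym 'a oassign = "nat \<Rightarrow> 'a"
type_synonym 'a cassign = "nat \<Rightarrow> nat \<Rightarrow> 'a list set"

definition assignment :: "'a henkin_structure \<Rightarrow> 'a oassign \<Rightarrow> 'a cassign \<Rightarrow> bool" where
  "assignment M e E \<longleftrightarrow> (\<forall>i. e i \<in> Obj M) \<and> (\<forall>n\<ge>1. \<forall>i. E n i \<in> Conc M n)"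

definition upd_tuple :: "'a oassign \<Rightarrow> nat list \<Rightarrow> 'a list \<Rightarrow> 'a oassign" where
  "upd_tuple e xs as = (\<lambda>i. case map_of (zip xs as) i of Some a \<Rightarrow> a | None \<Rightarrow> e i)"

definition upd_conc :: "'a cassign \<Rightarrow> nat \<Rightarrow> nat \<Rightarrow> 'a list set \<Rightarrow> 'a cassign" where
  "upd_conc E n i X = E(n := (E n)(i := X))"

fun oval :: "'a henkin_structure \<Rightarrow> 'a oassign \<Rightarrow> 'a cassign \<Rightarrow> oterm \<Rightarrow> 'a"
  and cval :: "'a henkin_structure \<Rightarrow> 'a oassign \<Rightarrow> 'a cassign \<Rightarrow> cterm \<Rightarrow> 'a list set" where
  "oval M e E (OVar i) = e i"
| "oval M e E (Ext R) = ext M (cval M e E R)"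
| "cval M e E (CVar n i) = E n i"
| "cval M e E (Sect R ts) = section_at (cval M e E R) (map (oval M e E) ts)"

fun sat :: "'a henkin_structure \<Rightarrow> 'a oassign \<Rightarrow> 'a cassign \<Rightarrow> form \<Rightarrow> bool" where
  "sat M e E (EqO s t) \<longleftrightarrow> oval M e E s = oval M e E t"
| "sat M e E (EqC R S) \<longleftrightarrow> cval M e E R = cval M e E S"
| "sat M e E (Less s t) \<longleftrightarrow> less_obj M (oval M e E s) (oval M e E t)"
| "sat M e E (Pred R ts) \<longleftrightarrow> map (oval M e E) ts \<in> cval M e E R"
| "sat M e E (Neg p) \<longleftrightarrow> \<not> sat M e E p"
| "sat M e E (Conj p q) \<longleftrightarrow> sat M e E p \<and> sat M e E q"
| "sat M e E (ExO i p) \<longleftrightarrow> (\<exists>a\<in>Obj M. sat M (e(i := a)) E p)"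
| "sat M e E (ExC n i p) \<longleftrightarrow> (\<exists>X\<in>Conc M n. sat M e (upd_conc E n i X) p)"


section \<open>The theory \<open>\<Sigma>\<^sup>1\<^sub>1-LB + GC\<close>\<close>

text \<open>
  Each schema below states the truth in \<open>M\<close> of the universal closures of its instances: the
  assignment supplies the parameters. The concept \<open>R\<close> asserted to exist is not assigned to a
  variable of \<open>p\<close>, which is the proviso that \<open>R\<close> is not free in \<open>p\<close>. All formulas
  range over the signature with \<open><\<close>.
\<close>

definition basic_law_V :: "'a henkin_structure \<Rightarrow> bool" where
  "basic_law_V M \<longleftrightarrow> (\<forall>X\<in>Conc M 1. \<forall>Y\<in>Conc M 1. ext M X = ext M Y \<longleftrightarrow> X = Y)"

definition first_order_comprehension :: "'a henkin_structure \<Rightarrow> bool" where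
  "first_order_comprehension M \<longleftrightarrow>
     (\<forall>p xs e E. wf_form p \<and> first_order p \<and> distinct xs \<and> length xs \<ge> 1 \<and> assignment M e E \<longrightarrow>
        (\<exists>R\<in>Conc M (length xs). \<forall>as\<in>tuples (Obj M) (length xs).
           as \<in> R \<longleftrightarrow> sat M (upd_tuple e xs as) E p))"

text \<open>
  In \<open>p(x\<^sub>1,\<dots>,x\<^sub>n,R')\<close> the variable \<open>R'\<close> is \<open>CVar m i\<close>; \<open>p(x\<^sub>1,\<dots>,x\<^sub>n,R[x\<^sub>1,\<dots>,x\<^sub>n])\<close> is evaluated
  by assigning to \<open>R'\<close> the value of the term \<open>R[x\<^sub>1,\<dots>,x\<^sub>n]\<close>.
\<close>

definition sigma11_choice :: "'a henkin_structure \<Rightarrow> bool" where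
  "sigma11_choice M \<longleftrightarrow>
     (\<forall>p xs m i e E. wf_form p \<and> sigma11 p \<and> distinct xs \<and> length xs \<ge> 1 \<and> m \<ge> 1 \<and>
        assignment M e E \<longrightarrow>
        (\<forall>as\<in>tuples (Obj M) (length xs). \<exists>X\<in>Conc M m.
           sat M (upd_tuple e xs as) (upd_conc E m i X) p) \<longrightarrow>
        (\<exists>R\<in>Conc M (length xs + m). \<forall>as\<in>tuples (Obj M) (length xs).
           sat M (upd_tuple e xs as) (upd_conc E m i (section_at R as)) p))"

definition linear_order_obj :: "'a henkin_structure \<Rightarrow> bool" where
  "linear_order_obj M \<longleftrightarrow>
     (\<forall>a\<in>Obj M. \<not> less_obj M a a) \<and>
     (\<forall>a\<in>Obj M. \<forall>b\<in>Obj M. \<forall>c\<in>Obj M. less_obj M a b \<and> less_obj M b c \<longrightarrow> less_obj M a c) \<and>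
     (\<forall>a\<in>Obj M. \<forall>b\<in>Obj M. less_obj M a b \<or> a = b \<or> less_obj M b a)"

definition least_element_schema :: "'a henkin_structure \<Rightarrow> bool" where
  "least_element_schema M \<longleftrightarrow>
     (\<forall>p x e E. wf_form p \<and> assignment M e E \<longrightarrow>
        (\<exists>a\<in>Obj M. sat M (e(x := a)) E p) \<longrightarrow>
        (\<exists>a\<in>Obj M. sat M (e(x := a)) E p \<and>
           (\<forall>b\<in>Obj M. less_obj M b a \<longrightarrow> \<not> sat M (e(x := b)) E p)))"

definition model_sigma11_LB_GC :: "'a henkin_structure \<Rightarrow> bool" where
  "model_sigma11_LB_GC M \<longleftrightarrow>
     is_henkin_structure M \<and> basic_law_V M \<and> first_order_comprehension M \<and> sigma11_choice M \<and>
     linear_order_obj M \<and> least_element_schema M"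


section \<open>Well-founded extensions\<close>

definition eta :: "'a henkin_structure \<Rightarrow> 'a \<Rightarrow> 'a \<Rightarrow> bool" where
  "eta M a b \<longleftrightarrow> (\<exists>B\<in>Conc M 1. ext M B = b \<and> [a] \<in> B)"

definition extensions :: "'a henkin_structure \<Rightarrow> 'a set" where
  "extensions M = ext M ` Conc M 1"

definition sub_eta :: "'a henkin_structure \<Rightarrow> 'a \<Rightarrow> 'a \<Rightarrow> bool" where
  "sub_eta M a b \<longleftrightarrow> (\<forall>c\<in>Obj M. eta M c a \<longrightarrow> eta M c b)"

text \<open>
  The description is proper for every extension \<open>x\<close> of a model of Basic Law V and first-order
  comprehension.
\<close>

definition sigma :: "'a henkin_structure \<Rightarrow> 'a \<Rightarrow> 'a" where
  "sigma M x = (THE y. \<exists>F\<in>Conc M 1. \<exists>G\<in>Conc M 1. x = ext M F \<and> y = ext M G \<and>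
     (\<forall>z\<in>Obj M. [z] \<in> G \<longleftrightarrow> [z] \<in> F \<or> z = x))"

definition eta_transitive :: "'a henkin_structure \<Rightarrow> 'a list set \<Rightarrow> bool" where
  "eta_transitive M F \<longleftrightarrow> (\<forall>x\<in>Obj M. \<forall>y\<in>Obj M. [x] \<in> F \<and> eta M y x \<longrightarrow> [y] \<in> F)"

definition trcl_eta :: "'a henkin_structure \<Rightarrow> 'a \<Rightarrow> 'a set" where
  "trcl_eta M x = {y \<in> Obj M. \<forall>F\<in>Conc M 1.
     eta_transitive M F \<and> sub_eta M x (ext M F) \<longrightarrow> [y] \<in> F}"

definition eta_wellfounded :: "'a henkin_structure \<Rightarrow> 'a set \<Rightarrow> bool" where
  "eta_wellfounded M C \<longleftrightarrow>
     (\<forall>F\<in>Conc M 1. F \<noteq> {} \<and> (\<forall>y\<in>Obj M. [y] \<in> F \<longrightarrow> y \<in> C) \<longrightarrow>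
        (\<exists>y\<in>Obj M. [y] \<in> F \<and> \<not> (\<exists>z\<in>Obj M. [z] \<in> F \<and> eta M z y)))"

definition wfExt :: "'a henkin_structure \<Rightarrow> 'a set" where
  "wfExt M = {x \<in> Obj M. x \<in> extensions M \<and>
     eta_wellfounded M (trcl_eta M (sigma M x)) \<and>
     trcl_eta M (sigma M x) \<subseteq> extensions M}"


section \<open>The theory \<open>ZFC - P\<close>\<close>

text \<open>
  A structure for the language of set theory is a domain \<open>D\<close> with a binary relation \<open>m\<close>,
  where \<open>m a b\<close> interprets \<open>a \<in> b\<close>. The finitely many single axioms are written out as their
  truth conditions in \<open>(D, m)\<close>; the schemata range over the following formulas.
\<close>

datatype sform =
    SMem nat nat
  | SEq nat nat
  | SNeg sform
  | SConj sform sform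
  | SEx nat sform

fun ssat :: "'a set \<Rightarrow> ('a \<Rightarrow> 'a \<Rightarrow> bool) \<Rightarrow> (nat \<Rightarrow> 'a) \<Rightarrow> sform \<Rightarrow> bool" where
  "ssat D m e (SMem i j) \<longleftrightarrow> m (e i) (e j)"
| "ssat D m e (SEq i j) \<longleftrightarrow> e i = e j"
| "ssat D m e (SNeg p) \<longleftrightarrow> \<not> ssat D m e p"
| "ssat D m e (SConj p q) \<longleftrightarrow> ssat D m e p \<and> ssat D m e q"
| "ssat D m e (SEx i p) \<longleftrightarrow> (\<exists>a\<in>D. ssat D m (e(i := a)) p)"

definition zf_extensionality :: "'a set \<Rightarrow> ('a \<Rightarrow> 'a \<Rightarrow> bool) \<Rightarrow> bool" where
  "zf_extensionality D m \<longleftrightarrow> (\<forall>a\<in>D. \<forall>b\<in>D. (\<forall>z\<in>D. m z a \<longleftrightarrow> m z b) \<longrightarrow> a = b)"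

definition is_upair :: "'a set \<Rightarrow> ('a \<Rightarrow> 'a \<Rightarrow> bool) \<Rightarrow> 'a \<Rightarrow> 'a \<Rightarrow> 'a \<Rightarrow> bool" where
  "is_upair D m a b c \<longleftrightarrow> (\<forall>z\<in>D. m z c \<longleftrightarrow> z = a \<or> z = b)"

definition zf_pairing :: "'a set \<Rightarrow> ('a \<Rightarrow> 'a \<Rightarrow> bool) \<Rightarrow> bool" where
  "zf_pairing D m \<longleftrightarrow> (\<forall>a\<in>D. \<forall>b\<in>D. \<exists>c\<in>D. is_upair D m a b c)"

definition zf_union :: "'a set \<Rightarrow> ('a \<Rightarrow> 'a \<Rightarrow> bool) \<Rightarrow> bool" where
  "zf_union D m \<longleftrightarrow> (\<forall>a\<in>D. \<exists>u\<in>D. \<forall>z\<in>D. m z u \<longleftrightarrow> (\<exists>y\<in>D. m y a \<and> m z y))"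

definition zf_infinity :: "'a set \<Rightarrow> ('a \<Rightarrow> 'a \<Rightarrow> bool) \<Rightarrow> bool" where
  "zf_infinity D m \<longleftrightarrow>
     (\<exists>w\<in>D. (\<exists>o\<^sub>0\<in>D. m o\<^sub>0 w \<and> (\<forall>z\<in>D. \<not> m z o\<^sub>0)) \<and>
        (\<forall>y\<in>D. m y w \<longrightarrow> (\<exists>s\<in>D. m s w \<and> (\<forall>z\<in>D. m z s \<longleftrightarrow> m z y \<or> z = y))))"

definition zf_foundation :: "'a set \<Rightarrow> ('a \<Rightarrow> 'a \<Rightarrow> bool) \<Rightarrow> bool" where
  "zf_foundation D m \<longleftrightarrow>
     (\<forall>a\<in>D. (\<exists>y\<in>D. m y a) \<longrightarrow> (\<exists>y\<in>D. m y a \<and> \<not> (\<exists>z\<in>D. m z a \<and> m z y)))"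

definition zf_separation :: "'a set \<Rightarrow> ('a \<Rightarrow> 'a \<Rightarrow> bool) \<Rightarrow> bool" where
  "zf_separation D m \<longleftrightarrow>
     (\<forall>p x e. (\<forall>i. e i \<in> D) \<longrightarrow>
        (\<forall>u\<in>D. \<exists>v\<in>D. \<forall>a\<in>D. m a v \<longleftrightarrow> m a u \<and> ssat D m (e(x := a)) p))"

definition zf_collection :: "'a set \<Rightarrow> ('a \<Rightarrow> 'a \<Rightarrow> bool) \<Rightarrow> bool" where
  "zf_collection D m \<longleftrightarrow>
     (\<forall>p x y e. x \<noteq> y \<and> (\<forall>i. e i \<in> D) \<longrightarrow>
        (\<forall>a\<in>D. \<exists>b\<in>D. ssat D m (e(x := a, y := b)) p) \<longrightarrow>
        (\<forall>u\<in>D. \<exists>v\<in>D. \<forall>a\<in>D. m a u \<longrightarrow> (\<exists>b\<in>D. m b v \<and> ssat D m (e(x := a, y := b)) p)))"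

text \<open>\<open>c\<close> is the Kuratowski pair of \<open>a\<close> and \<open>b\<close> in the sense of \<open>(D, m)\<close>.\<close>

definition is_opair :: "'a set \<Rightarrow> ('a \<Rightarrow> 'a \<Rightarrow> bool) \<Rightarrow> 'a \<Rightarrow> 'a \<Rightarrow> 'a \<Rightarrow> bool" where
  "is_opair D m a b c \<longleftrightarrow>
     (\<exists>s\<in>D. \<exists>t\<in>D. is_upair D m a a s \<and> is_upair D m a b t \<and> is_upair D m s t c)"

definition related_by :: "'a set \<Rightarrow> ('a \<Rightarrow> 'a \<Rightarrow> bool) \<Rightarrow> 'a \<Rightarrow> 'a \<Rightarrow> 'a \<Rightarrow> bool" where
  "related_by D m r a b \<longleftrightarrow> (\<exists>c\<in>D. is_opair D m a b c \<and> m c r)"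

text \<open>The element \<open>r\<close> of \<open>D\<close> is, in the sense of \<open>(D, m)\<close>, a strict well-ordering of \<open>u\<close>.\<close>

definition well_orders :: "'a set \<Rightarrow> ('a \<Rightarrow> 'a \<Rightarrow> bool) \<Rightarrow> 'a \<Rightarrow> 'a \<Rightarrow> bool" where
  "well_orders D m r u \<longleftrightarrow>
     (\<forall>a\<in>D. m a u \<longrightarrow> \<not> related_by D m r a a) \<and>
     (\<forall>a\<in>D. \<forall>b\<in>D. \<forall>c\<in>D. m a u \<and> m b u \<and> m c u \<and>
        related_by D m r a b \<and> related_by D m r b c \<longrightarrow> related_by D m r a c) \<and>
     (\<forall>a\<in>D. \<forall>b\<in>D. m a u \<and> m b u \<longrightarrow> related_by D m r a b \<or> a = b \<or> related_by D m r b a) \<and>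
     (\<forall>s\<in>D. (\<forall>z\<in>D. m z s \<longrightarrow> m z u) \<and> (\<exists>z\<in>D. m z s) \<longrightarrow>
        (\<exists>a\<in>D. m a s \<and> (\<forall>b\<in>D. m b s \<longrightarrow> \<not> related_by D m r b a)))"

definition zf_well_ordering :: "'a set \<Rightarrow> ('a \<Rightarrow> 'a \<Rightarrow> bool) \<Rightarrow> bool" where
  "zf_well_ordering D m \<longleftrightarrow> (\<forall>u\<in>D. \<exists>r\<in>D. well_orders D m r u)"

definition model_ZFC_minus_P :: "'a set \<Rightarrow> ('a \<Rightarrow> 'a \<Rightarrow> bool) \<Rightarrow> bool" where
  "model_ZFC_minus_P D m \<longleftrightarrow>
     zf_extensionality D m \<and> zf_pairing D m \<and> zf_union D m \<and> zf_infinity D m \<and>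
     zf_separation D m \<and> zf_collection D m \<and> zf_foundation D m \<and> zf_well_ordering D m"

end

theory Submission
  imports Defs "HOL-Library.Countable_Set_Type"
begin

text \<open>
  The objects are the natural numbers with their usual order, so the least element schema is
  immediate. Force with injective partial maps from unary concepts to numbers, together with a set of
  numbers forbidden as values, such that infinitely many numbers remain available. A fusion
  argument realises countably many monotone dense requirements in one condition. Take a
  countable family \<open>N\<close> of concepts, conditions and hereditarily countable sets, closed under
  witnesses for all the relations in question, and a generic chain of conditions in \<open>N\<close>; its
  union is \<open>\<partial>\<close> on the concepts of \<open>N\<close>. First-order formulas depend only on a condition that
  covers their parameters, which gives comprehension, and fusion gives choice. By genericity every
  hereditarily countable set in \<open>N\<close> gets a code \<open>\<partial>{code of x | x \<in> h}\<close>, and the transitive closure of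
  a number that is not such a code is ill-founded or contains a forbidden number. Hence the
  well-founded extensions are isomorphic to an elementary substructure of the hereditarily
  countable sets, which satisfy ZFC without power set.
\<close>

text \<open>The closure of \<open>N\<close> supplies only concepts computed from its own members,
  whereas the finished \<partial> arises afterwards, as a limit of the chain. Hence whatever the
  model must know has to be decided by a single condition of the chain: the truth of a first-order
  formula at given parameters, the set coded by a number, the transitive closure of a number. The
  last is the reason for forbidding numbers. A number without a value now might receive one later
  and bring new members with it, so the closure would be settled only in the limit; forbidding such
  a number keeps it out of the range for good.

  Choice is the axiom that asks for fusion. A \<Sigma>11 formula true under a condition stays true
  under its extensions, but it may become true later. Witnesses for infinitely many tuples therefore
  show up under different extensions, and one condition has to collect them all without using up the
  numbers. Since conditions are infinite objects, an increasing union could do just that; a reserve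
  of values growing along the construction prevents it.\<close>

instance oterm :: countable by countable_datatype
instance cterm :: countable by countable_datatype
instance form :: countable by countable_datatype
instance sform :: countable by countable_datatype

subsection \<open>Hereditarily countable sets\<close>

text \<open>As the least type closed under countable subsets, it has one element for each
  hereditarily countable set; foundation is its structural induction.\<close>

datatype hc = HC (el: "hc cset")

definition elems :: "hc \<Rightarrow> hc set" where
  "elems h = rcset (el h)"

text \<open>Meaningful for countable \<open>A\<close> only, because \<open>acset\<close> is
  unspecified elsewhere.\<close>

definition hset :: "hc set \<Rightarrow> hc" where
  "hset A = HC (acset A)"

lemma countable_elems [simp]: "countable (elems h)"
  by (simp add: elems_def)

lemma elems_hset [simp]: "countable A \<Longrightarrow> elems (hset A) = A"
  by (simp add: elems_def hset_def acset_inverse)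

lemma hc_eqI: "elems a = elems b \<Longrightarrow> a = b"
  by (metis elems_def hc.expand rcset_inject)

lemma hc_induct [case_names elems]:
  assumes "\<And>h. (\<And>x. x \<in> elems h \<Longrightarrow> P x) \<Longrightarrow> P h"
  shows "P h"
proof (induction h)
  case (HC A)
  show ?case
    by (rule assms) (use HC in \<open>auto simp: elems_def cin.rep_eq\<close>)
qed

lemma wf_elems: "wf {(x, h). x \<in> elems h}"
  unfolding wf_def by (auto intro: hc_induct)

subsection \<open>Countable hulls\<close>

text \<open>Closed Skolem terms: a node carries the number of a query, its subterms are the
  arguments. There are countably many, and their values will form the hull.\<close>

datatype hterm = HTerm nat "hterm list"

instance hterm :: countable by countable_datatype

primrec hval :: "(nat \<Rightarrow> 'i list \<Rightarrow> 'i) \<Rightarrow> hterm \<Rightarrow> 'i" where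
  "hval F (HTerm k ts) = F k (map (hval F) ts)"

text \<open>A Loewenheim-Skolem argument for countably many relations. Arguments come as a list, so
  that one query may take any finite number of parameters.\<close>

lemma countable_hull:
  fixes \<Phi> :: "'k::countable \<Rightarrow> 'i list \<Rightarrow> 'i \<Rightarrow> bool"
  shows "\<exists>N. countable N \<and> (\<forall>k xs y. set xs \<subseteq> N \<longrightarrow> \<Phi> k xs y \<longrightarrow> (\<exists>y\<in>N. \<Phi> k xs y))"
proof -
  \<comment> \<open>Where no witness exists the value is arbitrary; closure demands nothing
    there.\<close>
  define F where "F k xs = (SOME y. \<Phi> (from_nat k) xs y)" for k xs
  define val where "val = hval F"
  have val: "val (HTerm k ts) = F k (map val ts)" for k ts
    by (simp add: val_def)
  have "\<exists>y\<in>range val. \<Phi> k xs y" if "set xs \<subseteq> range val" and y: "\<Phi> k xs y" for k xs y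
  proof -
    have "xs \<in> map val ` lists UNIV"
      unfolding lists_image[symmetric] using that(1) by (auto simp: in_lists_conv_set)
    then obtain ts where xs: "xs = map val ts" by blast
    have "F (to_nat k) xs = val (HTerm (to_nat k) ts)" unfolding val xs ..
    moreover have "\<Phi> k xs (F (to_nat k) xs)"
      unfolding F_def using someI[of "\<Phi> k xs", OF y] by simp
    ultimately show ?thesis by auto
  qed
  then show ?thesis by (intro exI[of _ "range val"] conjI allI impI) simp_all
qed

subsection \<open>Conditions\<close>

type_synonym conc = "nat list set"
type_synonym assoc = "conc \<Rightarrow> nat option"
type_synonym cond = "assoc \<times> nat set"

text \<open>Domains are typically infinite, since covering one concept of higher arity already gives
  values to all its unary sections. Room for further values is thus not automatic, and the last
  clause demands it.\<close>

definition is_cond :: "cond \<Rightarrow> bool" where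
  "is_cond q \<longleftrightarrow> dom (fst q) \<subseteq> Pow (tuples UNIV 1) \<and> inj_on (fst q) (dom (fst q)) \<and>
     ran (fst q) \<inter> snd q = {} \<and> infinite (- (ran (fst q) \<union> snd q))"

definition extends :: "cond \<Rightarrow> cond \<Rightarrow> bool" (infix "\<unlhd>" 50) where
  "q' \<unlhd> q \<longleftrightarrow> fst q \<subseteq>\<^sub>m fst q' \<and> snd q \<subseteq> snd q'"

lemma extends_refl [simp]: "q \<unlhd> q"
  by (simp add: extends_def)

lemma extends_trans [trans]: "r \<unlhd> q \<Longrightarrow> q \<unlhd> p \<Longrightarrow> r \<unlhd> p"
  by (auto simp: extends_def intro: map_le_trans)

lemma map_leD: "p \<subseteq>\<^sub>m p' \<Longrightarrow> p x = Some y \<Longrightarrow> p' x = Some y"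
  by (metis domI map_le_def)

lemma map_le_chain:
  assumes "\<And>k. p k \<subseteq>\<^sub>m p (Suc k)" "k \<le> l"
  shows "p k \<subseteq>\<^sub>m p l"
  using assms(2)
proof (induction rule: dec_induct)
  case (step n)
  show ?case by (rule map_le_trans[OF step.IH assms(1)])
qed simp

lemma assoc_inj: "is_cond q \<Longrightarrow> fst q X = Some n \<Longrightarrow> fst q Y = Some n \<Longrightarrow> X = Y"
  unfolding is_cond_def by (metis domI inj_onD)

definition dense :: "cond set \<Rightarrow> bool" where
  "dense D \<longleftrightarrow> (\<forall>q. is_cond q \<longrightarrow> (\<exists>q'. is_cond q' \<and> q' \<unlhd> q \<and> q' \<in> D))"

text \<open>The property looks at the assignment alone. This lets a fusion meet it below larger
  forbidden sets and release the added numbers afterwards.\<close>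

definition dense_below :: "cond \<Rightarrow> (assoc \<Rightarrow> bool) \<Rightarrow> bool" where
  "dense_below q E \<longleftrightarrow> (\<forall>q'. is_cond q' \<longrightarrow> q' \<unlhd> q \<longrightarrow> (\<exists>r. is_cond r \<and> r \<unlhd> q' \<and> E (fst r)))"

lemma is_cond_insert_forbidden:
  assumes "is_cond (p, B)" "r \<notin> ran p"
  shows "is_cond (p, insert r B)"
proof -
  have "- (ran p \<union> insert r B) = - (ran p \<union> B) - {r}" by auto
  then have "infinite (- (ran p \<union> insert r B))" using assms(1) by (simp add: is_cond_def)
  then show ?thesis using assms by (simp add: is_cond_def)
qed

lemma is_cond_forbid_finite:
  assumes "is_cond (p, B)" "finite R" "R \<inter> ran p = {}"
  shows "is_cond (p, B \<union> R)"
  using assms(2,1,3)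
proof (induction R)
  case (insert r R)
  then show ?case using is_cond_insert_forbidden[of p "B \<union> R" r] by simp
qed simp

lemma is_cond_assign:
  assumes c: "is_cond (p, B)" and X: "X \<subseteq> tuples UNIV 1"
  shows "\<exists>p'. is_cond (p', B) \<and> p \<subseteq>\<^sub>m p' \<and> X \<in> dom p'"
proof (cases "X \<in> dom p")
  case False
  have "infinite (- (ran p \<union> B))" using c by (simp add: is_cond_def)
  then obtain n where n: "n \<notin> ran p" "n \<notin> B"
    by (metis Compl_iff UnCI finite.emptyI equals0I)
  have r: "ran (p(X \<mapsto> n)) = insert n (ran p)" using False by auto
  have "inj_on p (dom p)" using c by (simp add: is_cond_def)
  then have i: "inj_on (p(X \<mapsto> n)) (dom (p(X \<mapsto> n)))"
    using n(1) False by (auto simp: inj_on_def ran_def)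
  have f: "infinite (- (insert n (ran p) \<union> B))"
  proof -
    have "- (insert n (ran p) \<union> B) = - (ran p \<union> B) - {n}" by auto
    then show ?thesis using \<open>infinite (- (ran p \<union> B))\<close> by simp
  qed
  have "is_cond (p(X \<mapsto> n), B)"
    using c X n i f unfolding is_cond_def fst_conv snd_conv r by auto
  moreover have "p \<subseteq>\<^sub>m p(X \<mapsto> n)" using False by (auto simp: map_le_def)
  ultimately show ?thesis by (intro exI[of _ "p(X \<mapsto> n)"]) auto
qed (use c in auto)

section \<open>Unions of increasing chains, fusion and generic chains\<close>

definition ch_union :: "(nat \<Rightarrow> assoc) \<Rightarrow> assoc" where
  "ch_union p X = (if \<exists>k. X \<in> dom (p k) then p (LEAST k. X \<in> dom (p k)) X else None)"

lemma ch_union_Some: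
  assumes "\<And>k. p k \<subseteq>\<^sub>m p (Suc k)"
  shows "ch_union p X = Some n \<longleftrightarrow> (\<exists>k. p k X = Some n)"
proof -
  have mono: "p k \<subseteq>\<^sub>m p l" if "k \<le> l" for k l
    using assms that by (rule map_le_chain)
  show ?thesis
  proof
    assume "ch_union p X = Some n"
    then show "\<exists>k. p k X = Some n" by (auto simp: ch_union_def split: if_splits)
  next
    assume "\<exists>k. p k X = Some n"
    then obtain k where k: "p k X = Some n" ..
    then have "X \<in> dom (p (LEAST k. X \<in> dom (p k)))" by (intro LeastI) auto
    moreover have "(LEAST k. X \<in> dom (p k)) \<le> k" using k by (intro Least_le) auto
    ultimately have "p (LEAST k. X \<in> dom (p k)) X = Some n"
      using k mono[of "LEAST k. X \<in> dom (p k)" k] by (simp add: map_le_def)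
    then show "ch_union p X = Some n" using k by (auto simp: ch_union_def)
  qed
qed

text \<open>The stages could exhaust the numbers in the limit; the infinite set \<open>R\<close>,
  avoided by all of them, is what remains available.\<close>

lemma is_cond_ch_union:
  assumes mono: "\<And>k. p k \<subseteq>\<^sub>m p (Suc k)" and c: "\<And>k. is_cond (p k, B)"
    and R: "infinite R" "R \<inter> B = {}" "\<And>k. ran (p k) \<inter> R = {}"
  shows "is_cond (ch_union p, B)"
proof -
  note S = ch_union_Some[of p, OF mono]
  have le: "p k \<subseteq>\<^sub>m p l" if "k \<le> l" for k l
    using mono that by (rule map_le_chain)
  have "X = Y" if "p k X = Some n" "p l Y = Some n" for k l X Y n
    using map_leD[OF le[OF max.cobounded1] that(1), of l]
      map_leD[OF le[OF max.cobounded2] that(2), of k] assoc_inj[OF c[of "max k l"]]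
    by simp
  then have inj: "inj_on (ch_union p) (dom (ch_union p))"
    unfolding inj_on_def by (metis S domD)
  have dom: "dom (ch_union p) \<subseteq> Pow (tuples UNIV 1)"
  proof
    fix X assume "X \<in> dom (ch_union p)"
    then obtain k n where "p k X = Some n" by (auto simp: S)
    with c[of k] show "X \<in> Pow (tuples UNIV 1)" by (auto simp: is_cond_def)
  qed
  have ran: "ran (ch_union p) = (\<Union>k. ran (p k))"
    by (auto simp: ran_def S)
  have "R \<subseteq> - (ran (ch_union p) \<union> B)" using R by (auto simp: ran)
  then have "infinite (- (ran (ch_union p) \<union> B))" using R(1) finite_subset by blast
  moreover have "ran (ch_union p) \<inter> B = {}" using c by (auto simp: ran is_cond_def)
  ultimately show ?thesis using inj dom by (simp add: is_cond_def)
qed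

text \<open>The values reserved along the construction are forbidden only temporarily, and stay
  available for extensions of the limit.\<close>

lemma fusion:
  fixes E :: "nat \<Rightarrow> assoc \<Rightarrow> bool"
  assumes c: "is_cond (p, B)" and E: "\<And>n. dense_below (p, B) (E n)"
    and mono: "\<And>n p p'. E n p \<Longrightarrow> p \<subseteq>\<^sub>m p' \<Longrightarrow> E n p'"
  shows "\<exists>p'. is_cond (p', B) \<and> p \<subseteq>\<^sub>m p' \<and> (\<forall>n. E n p')"
proof -
  \<comment> \<open>A state is an assignment with a finite reserve of values. The reserve grows
    strictly at each step, which makes the set of all reserved values infinite in the end.\<close>
  define ok where "ok s \<longleftrightarrow> is_cond (fst s, B) \<and> p \<subseteq>\<^sub>m fst s \<and> finite (snd s) \<and>
    snd s \<inter> (ran (fst s) \<union> B) = {}" for s :: "assoc \<times> nat set"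
  define step where "step n s s' \<longleftrightarrow> fst s \<subseteq>\<^sub>m fst s' \<and> snd s \<subset> snd s' \<and> E n (fst s')"
    for n and s s' :: "assoc \<times> nat set"
  have ex: "\<exists>s'. ok s' \<and> step n s s'" if s: "ok s" for n s
  proof -
    \<comment> \<open>Forbidding the reserve while \<open>E n\<close> is being met keeps the
      reserved values unassigned.\<close>
    have "is_cond (fst s, B \<union> snd s)" using s unfolding ok_def
      by (intro is_cond_forbid_finite) auto
    moreover have "(fst s, B \<union> snd s) \<unlhd> (p, B)" using s by (auto simp: extends_def ok_def)
    ultimately obtain r where r: "is_cond r" "r \<unlhd> (fst s, B \<union> snd s)" "E n (fst r)"
      using E[of n] unfolding dense_below_def by blast
    have "infinite (- (ran (fst r) \<union> snd r))" using r(1) by (simp add: is_cond_def)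
    then obtain x where x: "x \<notin> ran (fst r)" "x \<notin> snd r"
      by (metis Compl_iff UnCI finite.emptyI equals0I)
    have sr: "B \<union> snd s \<subseteq> snd r" "fst s \<subseteq>\<^sub>m fst r" using r(2) by (auto simp: extends_def)
    \<comment> \<open>The forbidden set returns from \<open>snd r\<close> to \<open>B\<close>: the
      requirement \<open>E n\<close> concerns only \<open>fst r\<close>.\<close>
    have "infinite (- (ran (fst r) \<union> B))"
      using \<open>infinite (- (ran (fst r) \<union> snd r))\<close> by (rule infinite_super[rotated]) (use sr in auto)
    then have "is_cond (fst r, B)" using r(1) sr by (auto simp: is_cond_def)
    moreover have "ran (fst r) \<inter> snd r = {}" using r(1) by (auto simp: is_cond_def)
    moreover have "p \<subseteq>\<^sub>m fst r" using s sr(2) by (auto simp: ok_def intro: map_le_trans)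
    ultimately have "ok (fst r, insert x (snd s))" using s sr(1) x
      unfolding ok_def by auto
    moreover have "step n s (fst r, insert x (snd s))" using x sr r by (auto simp: step_def)
    ultimately show ?thesis by blast
  qed
  have "ok (p, {})" using c by (simp add: ok_def)
  then have "\<exists>s. \<forall>n. (ok (s n) \<and> (n = 0 \<longrightarrow> s n = (p, {}))) \<and> step n (s n) (s (Suc n))"
    by (intro dependent_nat_choice) (auto simp del: split_paired_Ex split_paired_All dest: ex)
  then obtain s where "\<forall>n. (ok (s n) \<and> (n = 0 \<longrightarrow> s n = (p, {}))) \<and> step n (s n) (s (Suc n))" ..
  then have s: "s 0 = (p, {})" "\<And>n. ok (s n)" "\<And>n. step n (s n) (s (Suc n))"
    by auto
  define f where "f = fst \<circ> s"
  define R where "R = (\<Union>n. snd (s n))"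
  have f: "f n \<subseteq>\<^sub>m f (Suc n)" for n using s(3)[of n] by (simp add: f_def step_def)
  have fle: "f k \<subseteq>\<^sub>m f l" if "k \<le> l" for k l
    using f that by (rule map_le_chain)
  have sub: "snd (s k) \<subseteq> snd (s l)" if "k \<le> l" for k l
    using that by (induction rule: dec_induct) (use s(3) in \<open>auto simp: step_def\<close>)
  have card: "n \<le> card (snd (s n))" for n
  proof (induction n)
    case (Suc n)
    have "card (snd (s n)) < card (snd (s (Suc n)))"
      using s(2)[of "Suc n"] s(3)[of n] by (intro psubset_card_mono) (auto simp: ok_def step_def)
    with Suc show ?case by linarith
  qed simp
  have "infinite R"
  proof
    assume "finite R"
    then have "card (snd (s (Suc (card R)))) \<le> card R" by (intro card_mono) (auto simp: R_def)
    with card[of "Suc (card R)"] show False by linarith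
  qed
  moreover have "R \<inter> B = {}" using s(2) by (auto simp: R_def ok_def)
  moreover have "ran (f k) \<inter> R = {}" for k
  proof -
    have "x \<notin> snd (s l)" if "x \<in> ran (f k)" for x l
    proof
      assume "x \<in> snd (s l)"
      then have "x \<in> snd (s (max k l))" using sub[of l "max k l"] by auto
      moreover have "x \<in> ran (f (max k l))" using that fle[of k "max k l"]
        by (auto simp: ran_def dest: map_leD)
      ultimately show False using s(2)[of "max k l"] by (auto simp: ok_def f_def)
    qed
    then show ?thesis by (auto simp: R_def)
  qed
  moreover have "is_cond (f k, B)" for k using s(2)[of k] by (simp add: ok_def f_def)
  ultimately have cu: "is_cond (ch_union f, B)" by (intro is_cond_ch_union f)
  have fu: "f k \<subseteq>\<^sub>m ch_union f" for k
    unfolding map_le_def using ch_union_Some[of f, OF f] by (metis domD)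
  have "E n (ch_union f)" for n
    using mono[OF _ fu[of "Suc n"]] s(3)[of n] by (simp add: step_def f_def)
  moreover have "p \<subseteq>\<^sub>m ch_union f" using fu[of 0] s(1) by (simp add: f_def)
  ultimately show ?thesis using cu by blast
qed

text \<open>Density is required inside \<open>G\<close>, since the chain must consist of conditions
  from the countable hull.\<close>

lemma rasiowa_sikorski:
  assumes "countable \<D>" "\<D> \<noteq> {}" "G \<noteq> {}"
    and dense: "\<And>D q. D \<in> \<D> \<Longrightarrow> q \<in> G \<Longrightarrow> \<exists>q'\<in>G. q' \<unlhd> q \<and> q' \<in> D"
  shows "\<exists>g :: nat \<Rightarrow> cond. (\<forall>k. g k \<in> G) \<and> (\<forall>k. g (Suc k) \<unlhd> g k) \<and> (\<forall>D\<in>\<D>. \<exists>k. g k \<in> D)"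
proof -
  have "\<exists>g. \<forall>n. g n \<in> G \<and> (g (Suc n) \<unlhd> g n \<and> g (Suc n) \<in> from_nat_into \<D> n)"
  proof (rule dependent_nat_choice)
    show "\<exists>q. q \<in> G" using \<open>G \<noteq> {}\<close> by blast
    show "\<exists>q'. q' \<in> G \<and> q' \<unlhd> q \<and> q' \<in> from_nat_into \<D> n" if "q \<in> G" for q n
      using dense[OF from_nat_into[OF \<open>\<D> \<noteq> {}\<close>] that] by blast
  qed
  then obtain g where g: "\<forall>n. g n \<in> G \<and> (g (Suc n) \<unlhd> g n \<and> g (Suc n) \<in> from_nat_into \<D> n)" ..
  moreover have "\<exists>k. g k \<in> D" if "D \<in> \<D>" for D
    using g from_nat_into_surj[OF assms(1) that] by metis
  ultimately show ?thesis by blast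
qed

subsection \<open>Coincidence\<close>

text \<open>One number bounds the object indices and, through \<open>n + i\<close>, both arity and
  index of the concept variables. Sums instead of maxima reduce passing to a subterm to
  arithmetic.\<close>

fun obound :: "oterm \<Rightarrow> nat" and cbound :: "cterm \<Rightarrow> nat" where
  "obound (OVar i) = Suc i"
| "obound (Ext R) = cbound R"
| "cbound (CVar n i) = Suc (n + i)"
| "cbound (Sect R ts) = cbound R + sum_list (map obound ts)"

fun fbound :: "form \<Rightarrow> nat" where
  "fbound (EqO s t) = obound s + obound t"
| "fbound (EqC R S) = cbound R + cbound S"
| "fbound (Less s t) = obound s + obound t"
| "fbound (Pred R ts) = cbound R + sum_list (map obound ts)"
| "fbound (Neg p) = fbound p"
| "fbound (Conj p q) = fbound p + fbound q"
| "fbound (ExO i p) = fbound p"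
| "fbound (ExC n i p) = fbound p"

definition agree :: "nat \<Rightarrow> 'a oassign \<Rightarrow> 'a oassign \<Rightarrow> 'a cassign \<Rightarrow> 'a cassign \<Rightarrow> bool" where
  "agree k e e' E E' \<longleftrightarrow> (\<forall>i<k. e i = e' i) \<and> (\<forall>n\<ge>1. \<forall>i. n + i < k \<longrightarrow> E n i = E' n i)"

lemma agree_upd:
  "agree k e e' E E' \<Longrightarrow> agree k (e(x := a)) (e'(x := a)) E E'"
  "agree k e e' E E' \<Longrightarrow> agree k e e' (upd_conc E n i X) (upd_conc E' n i X)"
  by (auto simp: agree_def upd_conc_def)

lemma upd_tuple_apply:
  "upd_tuple e xs as i = (case map_of (zip xs as) i of Some a \<Rightarrow> a | None \<Rightarrow> e i)"
  by (simp add: upd_tuple_def)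

lemma agree_upd_tuple:
  "agree k e e' E E' \<Longrightarrow> agree k (upd_tuple e xs as) (upd_tuple e' xs as) E E'"
  by (auto simp: agree_def upd_tuple_apply split: option.split)

lemma coincidence_terms:
  "wf_oterm t \<Longrightarrow> agree k e e' E E' \<Longrightarrow> obound t \<le> k \<Longrightarrow> oval M e E t = oval M e' E' t"
  "wf_cterm R \<Longrightarrow> agree k e e' E E' \<Longrightarrow> cbound R \<le> k \<Longrightarrow> cval M e E R = cval M e' E' R"
proof (induction t and R)
  case (Sect R ts)
  have "oval M e E t = oval M e' E' t" if "t \<in> set ts" for t
    using Sect.IH(2)[OF that] Sect.prems that member_le_sum_list[of "obound t" "map obound ts"]
    by auto
  then show ?case using Sect by (simp cong: map_cong)
qed (auto simp: agree_def)

lemma coincidence: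
  "wf_form \<phi> \<Longrightarrow> agree k e e' E E' \<Longrightarrow> fbound \<phi> \<le> k \<Longrightarrow> sat M e E \<phi> \<longleftrightarrow> sat M e' E' \<phi>"
proof (induction \<phi> arbitrary: e e' E E')
  case (Pred R ts)
  have "oval M e E t = oval M e' E' t" if "t \<in> set ts" for t
    using Pred.prems that member_le_sum_list[of "obound t" "map obound ts"]
    by (intro coincidence_terms(1)[of t k]) auto
  then have "map (oval M e E) ts = map (oval M e' E') ts" by simp
  then show ?case using Pred coincidence_terms(2)[of R k e e' E E' M] by (simp del: map_eq_conv)
next
  case (EqO s t)
  then show ?case using coincidence_terms(1)[of _ k e e' E E' M] by simp
next
  case (EqC s t)
  then show ?case using coincidence_terms(2)[of _ k e e' E E' M] by simp
next
  case (Less s t)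
  then show ?case using coincidence_terms(1)[of _ k e e' E E' M] by simp
next
  case (ExO i \<phi>)
  then show ?case using agree_upd(1)[OF ExO.prems(2)] by (metis fbound.simps(7) sat.simps(7) wf_form.simps(7))
next
  case (ExC n i \<phi>)
  then show ?case using agree_upd(2)[OF ExC.prems(2)] by (metis fbound.simps(8) sat.simps(8) wf_form.simps(8))
next
  case (Conj \<phi> \<psi>)
  then show ?case by (metis add_leD1 add_leD2 fbound.simps(6) sat.simps(6) wf_form.simps(6))
qed auto

text \<open>An assignment is an infinite object and cannot be named by a query. A finite list can;
  it is read as an assignment whose defaults, \<open>0\<close> here and \<open>{}\<close> below, are
  legitimate in every sort.\<close>

definition obj_params :: "nat list \<Rightarrow> nat oassign" where
  "obj_params es i = (if i < length es then es ! i else 0)"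

definition conc_params :: "'a list set list \<Rightarrow> 'a cassign" where
  "conc_params Rs n i = (if prod_encode (n, i) < length Rs then Rs ! prod_encode (n, i) else {})"

lemma finite_params:
  fixes e :: "nat oassign"
  obtains es Rs where "agree k e (obj_params es) E (conc_params Rs)"
    "\<And>n i. n \<ge> 1 \<Longrightarrow> conc_params Rs n i = E n i \<or> conc_params Rs n i = {}"
    "set Rs \<subseteq> insert {} {E n i |n i. n \<ge> 1}"
proof
  \<comment> \<open>\<open>E 0 i\<close> is unconstrained, so the places of arity 0 are filled with
    \<open>{}\<close>; this keeps the whole list within the concepts.\<close>
  define f where "f j = (case prod_decode j of (n, i) \<Rightarrow> if n = 0 then {} else E n i)" for j
  \<comment> \<open>Crude but sufficient: the sum of the codes bounds each code of a pair with
    \<open>n + i < k\<close>, and \<open>Suc\<close> makes the bound strict.\<close>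
  define m where "m = Suc (\<Sum>n<k. \<Sum>i<k. prod_encode (n, i))"
  define Rs where "Rs = map f [0..<m]"
  have "prod_encode (n, i) < m" if "n + i < k" for n i
  proof -
    have "prod_encode (n, i) \<le> (\<Sum>i<k. prod_encode (n, i))"
      using that by (intro member_le_sum) auto
    also have "\<dots> \<le> (\<Sum>n<k. \<Sum>i<k. prod_encode (n, i))"
      using that by (intro member_le_sum[of n _ "\<lambda>n. \<Sum>i<k. prod_encode (n, i)"]) auto
    finally show ?thesis by (simp add: m_def)
  qed
  then show "agree k e (obj_params (map e [0..<k])) E (conc_params Rs)"
    by (auto simp: agree_def obj_params_def conc_params_def Rs_def f_def)
  show "conc_params Rs n i = E n i \<or> conc_params Rs n i = {}" if "n \<ge> 1" for n i
    using that by (auto simp: conc_params_def Rs_def f_def)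
  show "set Rs \<subseteq> insert {} {E n i |n i. n \<ge> 1}"
  proof
    fix X assume "X \<in> set Rs"
    then obtain n i where "X = (if n = 0 then {} else E n i)"
      by (auto simp: Rs_def f_def split: prod.splits)
    then show "X \<in> insert {} {E n i |n i. n \<ge> 1}" by (cases n) auto
  qed
qed

subsection \<open>Partial structures\<close>

definition Str :: "(nat \<Rightarrow> conc set) \<Rightarrow> (conc \<Rightarrow> nat) \<Rightarrow> nat henkin_structure" where
  "Str K d = \<lparr>Obj = UNIV, Conc = K, ext = d, less_obj = (<)\<rparr>"

lemma Str_simps [simp]:
  "Obj (Str K d) = UNIV" "Conc (Str K d) = K" "ext (Str K d) = d" "less_obj (Str K d) = (<)"
  by (simp_all add: Str_def)

text \<open>The \<open>n\<close>-ary concepts all of whose unary sections have a value under \<open>p\<close>: by these sections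
  alone do first-order formulas depend on \<open>\<partial>\<close>.\<close>

definition Cov :: "assoc \<Rightarrow> nat \<Rightarrow> conc set" where
  "Cov p n = {R. R \<subseteq> tuples UNIV n \<and> (\<forall>as. Suc (length as) = n \<longrightarrow> section_at R as \<in> dom p)}"

text \<open>The structure as far as \<open>p\<close> knows it. On covered unary concepts
  \<open>the\<close> returns a genuine value, and concept quantifiers range over more concepts as
  \<open>p\<close> grows.\<close>

definition PStr :: "assoc \<Rightarrow> nat henkin_structure" where
  "PStr p = Str (Cov p) (the \<circ> p)"

lemma PStr_simps [simp]:
  "Obj (PStr p) = UNIV" "Conc (PStr p) = Cov p" "ext (PStr p) = the \<circ> p" "less_obj (PStr p) = (<)"
  by (simp_all add: PStr_def)

definition cov_assign :: "assoc \<Rightarrow> nat cassign \<Rightarrow> bool" where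
  "cov_assign p E \<longleftrightarrow> (\<forall>n\<ge>1. \<forall>i. E n i \<in> Cov p n)"

lemma section_at_Nil [simp]: "section_at R [] = R"
  by (simp add: section_at_def)

lemma section_at_append: "section_at (section_at R as) bs = section_at R (as @ bs)"
  by (simp add: section_at_def)

lemma section_at_tuples:
  "R \<subseteq> tuples A n \<Longrightarrow> length as \<le> n \<Longrightarrow> section_at R as \<subseteq> tuples A (n - length as)"
  by (fastforce simp: section_at_def tuples_def)

lemma Cov_mono: "p \<subseteq>\<^sub>m p' \<Longrightarrow> Cov p n \<subseteq> Cov p' n"
  unfolding Cov_def using map_le_implies_dom_le by blast

lemma Cov_1_dom: "X \<in> Cov p 1 \<Longrightarrow> X \<in> dom p"
  by (auto simp: Cov_def)

lemma Cov_section: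
  assumes "R \<in> Cov p n" "length as < n"
  shows "section_at R as \<in> Cov p (n - length as)"
proof -
  have "section_at R as \<subseteq> tuples UNIV (n - length as)"
    using assms by (intro section_at_tuples) (auto simp: Cov_def)
  then show ?thesis using assms by (auto simp: Cov_def section_at_append)
qed

definition extends_assoc :: "nat henkin_structure \<Rightarrow> assoc \<Rightarrow> bool" where
  "extends_assoc M p \<longleftrightarrow> Obj M = UNIV \<and> less_obj M = (<) \<and> (\<forall>X\<in>dom p. ext M X = the (p X))"

text \<open>A term applies \<partial> only to unary sections of its parameters, and these have
  values under \<open>p\<close>. That values of concept terms stay covered is what carries the
  induction.\<close>

lemma absolute_terms:
  assumes "extends_assoc M p" "cov_assign p E"
  shows "wf_oterm t \<Longrightarrow> oval M e E t = oval (PStr p) e E t"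
    and "wf_cterm R \<Longrightarrow> cval M e E R = cval (PStr p) e E R \<and> cval (PStr p) e E R \<in> Cov p (arity R)"
proof (induction t and R)
  case (Ext R)
  then show ?case using assms Cov_1_dom by (auto simp: extends_assoc_def)
next
  case (CVar n i)
  then show ?case using assms by (simp add: cov_assign_def)
next
  case (Sect R ts)
  then have "map (oval M e E) ts = map (oval (PStr p) e E) ts" by auto
  moreover have "section_at (cval (PStr p) e E R) (map (oval (PStr p) e E) ts)
      \<in> Cov p (arity R - length (map (oval (PStr p) e E) ts))"
    using Sect by (intro Cov_section) auto
  ultimately show ?case using Sect by (simp del: map_eq_conv)
qed auto

text \<open>Both structures have all numbers as objects, with the same order, so object quantifiers
  cause no difference and everything rests on the terms.\<close>

lemma absolute_first_order:
  assumes "extends_assoc M p" "cov_assign p E" "wf_form \<phi>" "first_order \<phi>"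
  shows "sat M e E \<phi> \<longleftrightarrow> sat (PStr p) e E \<phi>"
  using assms(3,4)
proof (induction \<phi> arbitrary: e)
  case (Pred R ts)
  then have "map (oval M e E) ts = map (oval (PStr p) e E) ts"
    using absolute_terms(1)[OF assms(1,2)] by auto
  then show ?case using absolute_terms(2)[OF assms(1,2)] Pred by (simp del: map_eq_conv)
qed (use assms(1) absolute_terms[OF assms(1,2)] in \<open>auto simp: extends_assoc_def\<close>)

lemma cov_assign_upd: "cov_assign p E \<Longrightarrow> X \<in> Cov p n \<Longrightarrow> cov_assign p (upd_conc E n i X)"
  by (auto simp: cov_assign_def upd_conc_def)

lemma cov_assign_mono: "cov_assign p E \<Longrightarrow> p \<subseteq>\<^sub>m p' \<Longrightarrow> cov_assign p' E"
  using Cov_mono by (fastforce simp: cov_assign_def)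

text \<open>Covered witnesses remain witnesses. The implication goes one way: \<open>M\<close> may
  contain witnesses that \<open>p\<close> does not cover.\<close>

lemma sigma11_upward:
  assumes "sigma11 \<phi>" "extends_assoc M p" "\<And>n. n \<ge> 1 \<Longrightarrow> Cov p n \<subseteq> Conc M n"
    "cov_assign p E" "wf_form \<phi>" "sat (PStr p) e E \<phi>"
  shows "sat M e E \<phi>"
  using assms
proof (induction arbitrary: E)
  case (1 \<phi>)
  then show ?case using absolute_first_order by blast
next
  case (2 \<phi> n i)
  from 2 obtain X where X: "X \<in> Cov p n" "sat (PStr p) e (upd_conc E n i X) \<phi>" by auto
  have "sat M e (upd_conc E n i X) \<phi>"
    using 2 X cov_assign_upd[OF \<open>cov_assign p E\<close> X(1)] by (intro "2.IH") auto
  then show ?case using X 2 by auto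
qed

lemma extends_assoc_PStr: "p \<subseteq>\<^sub>m p' \<Longrightarrow> extends_assoc (PStr p') p"
  by (auto simp: extends_assoc_def map_le_def)

lemma sigma11_persistent:
  assumes "sigma11 \<phi>" "p \<subseteq>\<^sub>m p'" "cov_assign p E" "wf_form \<phi>" "sat (PStr p) e E \<phi>"
  shows "sat (PStr p') e E \<phi>"
  using sigma11_upward[OF assms(1) extends_assoc_PStr[OF assms(2)] _ assms(3-5)]
    Cov_mono[OF assms(2)] by simp

subsection \<open>Dense sets\<close>

text \<open>Assigning infinitely many values is a limit process, hence the fusion. The forbidden set
  stays the same, so the lemma can be used inside further constructions.\<close>

lemma cover_countable:
  assumes c: "is_cond (p, B)" and X: "countable \<X>" "\<X> \<subseteq> Pow (tuples UNIV 1)"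
  shows "\<exists>p'. is_cond (p', B) \<and> p \<subseteq>\<^sub>m p' \<and> \<X> \<subseteq> dom p'"
proof (cases "\<X> = {}")
  case False
  have "\<exists>p'. is_cond (p', B) \<and> p \<subseteq>\<^sub>m p' \<and> (\<forall>n. from_nat_into \<X> n \<in> dom p')"
  proof (rule fusion[OF c])
    show "dense_below (p, B) (\<lambda>p. from_nat_into \<X> n \<in> dom p)" for n
      unfolding dense_below_def
    proof (intro allI impI)
      fix q assume "is_cond q"
      moreover have "from_nat_into \<X> n \<subseteq> tuples UNIV 1" using from_nat_into[OF False, of n] X(2) by auto
      ultimately obtain p' where "is_cond (p', snd q)" "fst q \<subseteq>\<^sub>m p'" "from_nat_into \<X> n \<in> dom p'"
        using is_cond_assign[of "fst q" "snd q" "from_nat_into \<X> n"] by auto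
      then show "\<exists>r. is_cond r \<and> r \<unlhd> q \<and> from_nat_into \<X> n \<in> dom (fst r)"
        by (intro exI[of _ "(p', snd q)"]) (auto simp: extends_def)
    qed
  next
    show "from_nat_into \<X> n \<in> dom p'" if "from_nat_into \<X> n \<in> dom p" "p \<subseteq>\<^sub>m p'" for n p p'
      using that by (auto dest: map_leD)
  qed
  moreover have "range (from_nat_into \<X>) = \<X>" using False X(1) by (rule range_from_nat_into)
  ultimately show ?thesis by (metis image_subset_iff)
qed (use c in auto)

definition D_cov :: "nat \<Rightarrow> conc \<Rightarrow> cond set" where
  "D_cov n R = {q. R \<in> Cov (fst q) n}"

text \<open>The first alternative refutes the premise of the choice instance in every extension.\<close>

definition D_choice :: "form \<Rightarrow> nat list \<Rightarrow> nat \<Rightarrow> nat \<Rightarrow> nat oassign \<Rightarrow> nat cassign \<Rightarrow> cond set" where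
  "D_choice \<phi> xs m i e E = {q. cov_assign (fst q) E \<and>
     ((\<exists>as\<in>tuples UNIV (length xs). \<forall>r. is_cond r \<longrightarrow> r \<unlhd> q \<longrightarrow>
          (\<forall>X\<in>Cov (fst r) m. \<not> sat (PStr (fst r)) (upd_tuple e xs as) (upd_conc E m i X) \<phi>)) \<or>
      (\<exists>R\<in>Cov (fst q) (length xs + m). \<forall>as\<in>tuples UNIV (length xs).
          sat (PStr (fst q)) (upd_tuple e xs as) (upd_conc E m i (section_at R as)) \<phi>))}"

lemma dense_D_cov:
  assumes "n \<ge> 1" "R \<subseteq> tuples UNIV n"
  shows "dense (D_cov n R)"
  unfolding dense_def
proof (intro allI impI)
  fix q assume c: "is_cond q"
  define \<X> where "\<X> = section_at R ` {as. Suc (length as) = n}"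
  have "section_at R as \<subseteq> tuples UNIV 1" if "Suc (length as) = n" for as
    using section_at_tuples[OF assms(2), of as] that by auto
  then have "countable \<X>" "\<X> \<subseteq> Pow (tuples UNIV 1)" by (auto simp: \<X>_def)
  then obtain p' where "is_cond (p', snd q)" "fst q \<subseteq>\<^sub>m p'" "\<X> \<subseteq> dom p'"
    using cover_countable[of "fst q" "snd q" \<X>] c by auto
  then show "\<exists>q'. is_cond q' \<and> q' \<unlhd> q \<and> q' \<in> D_cov n R"
    using assms by (intro exI[of _ "(p', snd q)"]) (auto simp: extends_def D_cov_def Cov_def \<X>_def)
qed

lemma cover_assignment:
  assumes c: "is_cond (p, B)" and E: "\<And>n i. n \<ge> 1 \<Longrightarrow> E n i \<subseteq> tuples UNIV n"
  shows "\<exists>p'. is_cond (p', B) \<and> p \<subseteq>\<^sub>m p' \<and> cov_assign p' E"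
proof -
  define \<X> where "\<X> = (\<lambda>(as, i). section_at (E (Suc (length as)) i) as) ` UNIV"
  have "section_at (E (Suc (length as)) i) as \<subseteq> tuples UNIV 1" for as i
    using section_at_tuples[OF E, of "Suc (length as)" as i] by auto
  then have "countable \<X>" "\<X> \<subseteq> Pow (tuples UNIV 1)" by (auto simp: \<X>_def)
  then obtain p' where p': "is_cond (p', B)" "p \<subseteq>\<^sub>m p'" "\<X> \<subseteq> dom p'"
    using cover_countable[OF c] by blast
  moreover have "cov_assign p' E"
    using p'(3) E by (auto simp: cov_assign_def Cov_def \<X>_def)
  ultimately show ?thesis by blast
qed

lemma tuples_UNIV: "as \<in> tuples UNIV n \<longleftrightarrow> length as = n"
  by (simp add: tuples_def)

text \<open>If no extension rules out all witnesses for some tuple, then below every extension each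
  tuple obtains a witness further down. Persistence makes these countably many requirements
  monotone, fusion meets them in one condition, and the witnesses are glued to a single
  \<open>R\<close>.\<close>

lemma dense_D_choice:
  assumes \<phi>: "wf_form \<phi>" "sigma11 \<phi>" and E: "\<And>n i. n \<ge> 1 \<Longrightarrow> E n i \<subseteq> tuples UNIV n"
    and m: "m \<ge> 1"
  shows "dense (D_choice \<phi> xs m i e E)"
  unfolding dense_def
proof (intro allI impI)
  fix q assume c: "is_cond q"
  obtain p B where "q = (p, B)" by fastforce
  then obtain p0 where p0: "is_cond (p0, B)" "p \<subseteq>\<^sub>m p0" "cov_assign p0 E"
    using cover_assignment[of p B E] c E by blast
  define T where "T = (tuples UNIV (length xs) :: nat list set)"
  have T: "T \<noteq> {}" "countable T"
    using tuples_UNIV[of "replicate (length xs) 0" "length xs"] by (auto simp: T_def)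
  define W where "W as p X \<longleftrightarrow> X \<in> Cov p m \<and> sat (PStr p) (upd_tuple e xs as) (upd_conc E m i X) \<phi>"
    for as p X
  show "\<exists>q'. is_cond q' \<and> q' \<unlhd> q \<and> q' \<in> D_choice \<phi> xs m i e E"
  proof (cases "\<exists>q'. is_cond q' \<and> q' \<unlhd> (p0, B) \<and> (\<exists>as\<in>T. \<forall>r. is_cond r \<longrightarrow> r \<unlhd> q' \<longrightarrow>
      (\<forall>X. \<not> W as (fst r) X))")
    case True
    then obtain q' where q': "is_cond q'" "q' \<unlhd> (p0, B)"
      "\<exists>as\<in>T. \<forall>r. is_cond r \<longrightarrow> r \<unlhd> q' \<longrightarrow> (\<forall>X. \<not> W as (fst r) X)" by blast
    have "cov_assign (fst q') E" using q'(2) p0(3) by (auto simp: extends_def intro: cov_assign_mono)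
    then have "q' \<in> D_choice \<phi> xs m i e E" using q'(3) by (auto simp: D_choice_def T_def W_def)
    moreover have "q' \<unlhd> q" using q'(2) p0(2) \<open>q = (p, B)\<close>
      by (auto simp: extends_def intro: map_le_trans)
    ultimately show ?thesis using q'(1) by blast
  next
    case False
    \<comment> \<open>Coverage of the parameters is part of the requirement because persistence of
      \<Sigma>11 truth depends on it; this makes \<open>Wn n\<close> monotone.\<close>
    define Wn where "Wn n p \<longleftrightarrow> cov_assign p E \<and> (\<exists>X. W (from_nat_into T n) p X)" for n p
    have Wmono: "W as p' X" if "W as p X" "cov_assign p E" "p \<subseteq>\<^sub>m p'" for as p p' X
      using that sigma11_persistent[OF \<phi>(2) that(3) cov_assign_upd[OF that(2)] \<phi>(1)]
        Cov_mono[OF that(3), of m] by (auto simp: W_def)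
    have "\<exists>p'. is_cond (p', B) \<and> p0 \<subseteq>\<^sub>m p' \<and> (\<forall>n. Wn n p')"
    proof (rule fusion[OF p0(1)])
      fix n
      show "dense_below (p0, B) (Wn n)"
        unfolding dense_below_def
      proof (intro allI impI)
        fix q' assume q': "is_cond q'" "q' \<unlhd> (p0, B)"
        then obtain r X where r: "is_cond r" "r \<unlhd> q'" "W (from_nat_into T n) (fst r) X"
          using False from_nat_into[OF T(1), of n] by blast
        have "p0 \<subseteq>\<^sub>m fst r" using extends_trans[OF r(2) q'(2)] by (simp add: extends_def)
        then have "cov_assign (fst r) E" using p0(3) by (auto intro: cov_assign_mono)
        then show "\<exists>r. is_cond r \<and> r \<unlhd> q' \<and> Wn n (fst r)" using r
          by (intro exI[of _ r]) (auto simp: Wn_def)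
      qed
    next
      show "Wn n p'" if "Wn n p" "p \<subseteq>\<^sub>m p'" for n p p'
        using that Wmono cov_assign_mono unfolding Wn_def by metis
    qed
    then obtain p' where p': "is_cond (p', B)" "p0 \<subseteq>\<^sub>m p'" "\<And>n. Wn n p'" by blast
    have "\<forall>as\<in>T. \<exists>X. W as p' X"
      using p'(3) from_nat_into_surj[OF T(2)] by (metis Wn_def)
    then obtain X where X: "\<And>as. as \<in> T \<Longrightarrow> W as p' (X as)" by metis
    \<comment> \<open>All tuples in \<open>T\<close> have the same length, so a list splits in at
      most one way and the glued pieces do not interfere.\<close>
    define R where "R = {as @ ys |as ys. as \<in> T \<and> ys \<in> X as}"
    have sec: "section_at R as = X as" if "as \<in> T" for as
      using that by (auto simp: section_at_def R_def T_def tuples_UNIV)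
    have Xt: "X as \<in> Cov p' m" if "as \<in> T" for as using X[OF that] by (simp add: W_def)
    have "R \<in> Cov p' (length xs + m)"
    proof -
      have "R \<subseteq> tuples UNIV (length xs + m)"
      proof
        fix l assume "l \<in> R"
        then obtain as ys where "l = as @ ys" "as \<in> T" "ys \<in> X as" by (auto simp: R_def)
        then show "l \<in> tuples UNIV (length xs + m)" using Xt[of as]
          by (auto simp: tuples_UNIV T_def Cov_def)
      qed
      \<comment> \<open>Since \<open>m \<ge> 1\<close>, a tuple that leaves one place open contains
        a full block of arguments for \<open>xs\<close>; the section is therefore a unary section of
        one chosen witness, and that witness is covered.\<close>
      moreover have "section_at R bs \<in> dom p'" if bs: "Suc (length bs) = length xs + m" for bs
      proof -
        let ?as = "take (length xs) bs" and ?cs = "drop (length xs) bs"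
        have "?as \<in> T" using bs m by (auto simp: T_def tuples_UNIV)
        moreover have "section_at R bs = section_at (section_at R ?as) ?cs"
          by (simp add: section_at_append)
        moreover have "Suc (length ?cs) = m" using bs m by auto
        ultimately show ?thesis using sec[of ?as] Xt[of ?as] by (auto simp: Cov_def)
      qed
      ultimately show ?thesis by (auto simp: Cov_def)
    qed
    moreover have "sat (PStr p') (upd_tuple e xs as) (upd_conc E m i (section_at R as)) \<phi>"
      if "as \<in> tuples UNIV (length xs)" for as
      using X[of as] sec[of as] that by (simp add: W_def T_def)
    moreover have "cov_assign p' E" using p0(3) p'(2) by (rule cov_assign_mono)
    ultimately have "(p', B) \<in> D_choice \<phi> xs m i e E"
      unfolding D_choice_def mem_Collect_eq fst_conv by blast
    moreover have "(p', B) \<unlhd> q" using p0(2) p'(2) \<open>q = (p, B)\<close>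
      by (auto simp: extends_def intro: map_le_trans)
    ultimately show ?thesis using p'(1) by blast
  qed
qed

subsection \<open>Codes of hereditarily countable sets\<close>

definition mem_in :: "assoc \<Rightarrow> nat \<Rightarrow> nat \<Rightarrow> bool" where
  "mem_in p a b \<longleftrightarrow> (\<exists>X. p X = Some b \<and> [a] \<in> X)"

text \<open>Reflexive, so as to correspond to the closure of \<open>sigma x\<close>, which has
  \<open>x\<close> itself as a member.\<close>

definition trcl_in :: "assoc \<Rightarrow> nat \<Rightarrow> nat set" where
  "trcl_in p x = {y. (mem_in p)\<^sup>*\<^sup>* y x}"

text \<open>\<open>codes p h n\<close>: the number \<open>n\<close> is \<open>p {[a] | a codes some x \<in> h}\<close>.\<close>

inductive codes :: "assoc \<Rightarrow> hc \<Rightarrow> nat \<Rightarrow> bool" for p where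
  "p X = Some n \<Longrightarrow> (\<And>x. x \<in> elems h \<Longrightarrow> \<exists>a. codes p x a \<and> [a] \<in> X) \<Longrightarrow>
   (\<And>as. as \<in> X \<Longrightarrow> \<exists>a. as = [a] \<and> (\<exists>x. x \<in> elems h \<and> codes p x a)) \<Longrightarrow> codes p h n"

lemma mem_in_mono: "mem_in p a b \<Longrightarrow> p \<subseteq>\<^sub>m p' \<Longrightarrow> mem_in p' a b"
  by (auto simp: mem_in_def dest: map_leD)

lemma codes_mono: "codes p h n \<Longrightarrow> p \<subseteq>\<^sub>m p' \<Longrightarrow> codes p' h n"
proof (induction rule: codes.induct)
  case (1 X n h)
  show ?case
  proof (rule codes.intros[of p' X])
    show "p' X = Some n" using 1(1) \<open>p \<subseteq>\<^sub>m p'\<close> by (auto dest: map_leD)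
  qed (use 1 in meson)+
qed

lemma codes_unique_code:
  assumes "codes p h n" "codes p h m"
  shows "n = m"
  using assms
proof (induction h arbitrary: n m rule: hc_induct)
  case (elems h)
  from elems.prems(1) obtain X where X: "p X = Some n" "\<And>x. x \<in> elems h \<Longrightarrow> \<exists>a. codes p x a \<and> [a] \<in> X"
      "\<And>as. as \<in> X \<Longrightarrow> \<exists>a. as = [a] \<and> (\<exists>x. x \<in> elems h \<and> codes p x a)"
    by cases blast
  from elems.prems(2) obtain Y where Y: "p Y = Some m" "\<And>x. x \<in> elems h \<Longrightarrow> \<exists>a. codes p x a \<and> [a] \<in> Y"
      "\<And>as. as \<in> Y \<Longrightarrow> \<exists>a. as = [a] \<and> (\<exists>x. x \<in> elems h \<and> codes p x a)"
    by cases blast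
  have "X \<subseteq> Y" using X(3) Y(2) elems.IH by blast
  moreover have "Y \<subseteq> X" using Y(3) X(2) elems.IH by blast
  ultimately show ?case using X(1) Y(1) by simp
qed

text \<open>Injectivity of the condition leaves only one concept with value \<open>n\<close>; its
  members are then compared by induction.\<close>

lemma codes_unique_set:
  assumes "is_cond q" "codes (fst q) h n" "codes (fst q) h' n"
  shows "h = h'"
  using assms(2,3)
proof (induction h arbitrary: h' n rule: hc_induct)
  case (elems h)
  from elems.prems(1) obtain X where X: "fst q X = Some n"
      "\<And>x. x \<in> elems h \<Longrightarrow> \<exists>a. codes (fst q) x a \<and> [a] \<in> X"
      "\<And>as. as \<in> X \<Longrightarrow> \<exists>a. as = [a] \<and> (\<exists>x. x \<in> elems h \<and> codes (fst q) x a)"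
    by cases blast
  from elems.prems(2) obtain Y where Y: "fst q Y = Some n"
      "\<And>x. x \<in> elems h' \<Longrightarrow> \<exists>a. codes (fst q) x a \<and> [a] \<in> Y"
      "\<And>as. as \<in> Y \<Longrightarrow> \<exists>a. as = [a] \<and> (\<exists>x. x \<in> elems h' \<and> codes (fst q) x a)"
    by cases blast
  have [simp]: "Y = X" using assoc_inj[OF assms(1) X(1) Y(1)] by simp
  have "elems h \<subseteq> elems h'"
  proof
    fix x assume x: "x \<in> elems h"
    then obtain a where a: "codes (fst q) x a" "[a] \<in> X" using X(2) by blast
    then obtain x' where "x' \<in> elems h'" "codes (fst q) x' a" using Y(3) by fastforce
    then show "x \<in> elems h'" using elems.IH[OF x a(1)] by simp
  qed
  moreover have "elems h' \<subseteq> elems h"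
  proof
    fix x' assume x': "x' \<in> elems h'"
    then obtain a where a: "codes (fst q) x' a" "[a] \<in> X" using Y(2) by fastforce
    then obtain x where "x \<in> elems h" "codes (fst q) x a" using X(3) by fastforce
    then show "x' \<in> elems h" using elems.IH[of x a x'] a(1) by simp
  qed
  ultimately show ?case by (intro hc_eqI) auto
qed

text \<open>By definition some code of each member lies in the concept; by uniqueness of codes it is
  the only one.\<close>

lemma codes_mem:
  assumes "is_cond q" "codes (fst q) h n"
  shows "mem_in (fst q) a n \<longleftrightarrow> (\<exists>x\<in>elems h. codes (fst q) x a)"
proof -
  from assms(2) obtain X where X: "fst q X = Some n"
      "\<And>x. x \<in> elems h \<Longrightarrow> \<exists>a. codes (fst q) x a \<and> [a] \<in> X"
      "\<And>as. as \<in> X \<Longrightarrow> \<exists>a. as = [a] \<and> (\<exists>x. x \<in> elems h \<and> codes (fst q) x a)"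
    by cases blast
  have "mem_in (fst q) a n \<longleftrightarrow> [a] \<in> X"
    unfolding mem_in_def using X(1) assoc_inj[OF assms(1) X(1)] by blast
  also have "\<dots> \<longleftrightarrow> (\<exists>x\<in>elems h. codes (fst q) x a)"
  proof
    assume "[a] \<in> X"
    from X(3)[OF this] show "\<exists>x\<in>elems h. codes (fst q) x a" by auto
  next
    assume "\<exists>x\<in>elems h. codes (fst q) x a"
    then obtain x where x: "x \<in> elems h" "codes (fst q) x a" by blast
    with X(2)[OF x(1)] codes_unique_code[OF x(2)] show "[a] \<in> X" by blast
  qed
  finally show ?thesis .
qed

definition D_code :: "hc \<Rightarrow> cond set" where
  "D_code h = {q. \<exists>n. codes (fst q) h n}"

text \<open>Induction on \<open>h\<close>: fusion codes the countably many members, and one further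
  value is given to the concept of their codes. The claim is for all \<open>p\<close> and
  \<open>B\<close> because the fusion applies the induction hypothesis to arbitrary
  extensions.\<close>

lemma code_cond:
  assumes "is_cond (p, B)"
  shows "\<exists>p'. is_cond (p', B) \<and> p \<subseteq>\<^sub>m p' \<and> (\<exists>n. codes p' h n)"
  using assms
proof (induction h arbitrary: p B rule: hc_induct)
  case (elems h)
  have "\<exists>p'. is_cond (p', B) \<and> p \<subseteq>\<^sub>m p' \<and> (\<forall>x\<in>elems h. \<exists>n. codes p' x n)"
  proof (cases "elems h = {}")
    case False
    define E where "E n p \<longleftrightarrow> (\<exists>a. codes p (from_nat_into (elems h) n) a)" for n p
    have "\<exists>p'. is_cond (p', B) \<and> p \<subseteq>\<^sub>m p' \<and> (\<forall>n. E n p')"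
    proof (rule fusion[OF elems.prems])
      show "dense_below (p, B) (E n)" for n
        unfolding dense_below_def
      proof (intro allI impI)
        fix q assume "is_cond q"
        then obtain p' where "is_cond (p', snd q)" "fst q \<subseteq>\<^sub>m p'" "E n p'"
          using elems.IH[OF from_nat_into[OF False], of "fst q" "snd q" n] by (auto simp: E_def)
        then show "\<exists>r. is_cond r \<and> r \<unlhd> q \<and> E n (fst r)"
          by (intro exI[of _ "(p', snd q)"]) (auto simp: extends_def)
      qed
      show "E n p'" if "E n p" "p \<subseteq>\<^sub>m p'" for n p p'
        using that codes_mono unfolding E_def by metis
    qed
    then obtain p' where "is_cond (p', B)" "p \<subseteq>\<^sub>m p'" "\<And>n. E n p'" by blast
    moreover have "\<exists>n. codes p' x n" if "x \<in> elems h" for x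
      using \<open>\<And>n. E n p'\<close> from_nat_into_surj[OF countable_elems that] by (metis E_def)
    ultimately show ?thesis by blast
  qed (use elems.prems in auto)
  then obtain p' where p': "is_cond (p', B)" "p \<subseteq>\<^sub>m p'" "\<And>x. x \<in> elems h \<Longrightarrow> \<exists>n. codes p' x n"
    by blast
  define X where "X = {[a] |a. \<exists>x\<in>elems h. codes p' x a}"
  have "X \<subseteq> tuples UNIV 1" by (auto simp: X_def tuples_UNIV)
  then obtain p'' n where p'': "is_cond (p'', B)" "p' \<subseteq>\<^sub>m p''" "p'' X = Some n"
    using is_cond_assign[OF p'(1), of X] by blast
  have "codes p'' h n"
  proof (rule codes.intros[of p'' X])
    show "\<exists>a. codes p'' x a \<and> [a] \<in> X" if "x \<in> elems h" for x
      using p'(3)[OF that] that codes_mono[OF _ p''(2)] by (auto simp: X_def)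
    show "\<exists>a. as = [a] \<and> (\<exists>x. x \<in> elems h \<and> codes p'' x a)" if "as \<in> X" for as
      using that codes_mono[OF _ p''(2)] by (auto simp: X_def)
  qed (rule p''(3))
  moreover have "p \<subseteq>\<^sub>m p''" using p'(2) p''(2) by (rule map_le_trans)
  ultimately show ?case using p''(1) by blast
qed

lemma dense_D_code: "dense (D_code h)"
  unfolding dense_def
proof (intro allI impI)
  fix q assume "is_cond q"
  then obtain p' where "is_cond (p', snd q)" "fst q \<subseteq>\<^sub>m p'" "\<exists>n. codes p' h n"
    using code_cond[of "fst q" "snd q" h] by auto
  then show "\<exists>q'. is_cond q' \<and> q' \<unlhd> q \<and> q' \<in> D_code h"
    by (intro exI[of _ "(p', snd q)"]) (auto simp: extends_def D_code_def)
qed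

text \<open>The closure of \<open>x\<close> is decided. Either all its elements have values, and
  then it is the same at every later stage; or one of them is barred from the range, and
  \<open>x\<close> cannot become a well-founded extension.\<close>

definition D_trcl :: "nat \<Rightarrow> cond set" where
  "D_trcl x = {q. trcl_in (fst q) x \<subseteq> ran (fst q) \<or> trcl_in (fst q) x \<inter> snd q \<noteq> {}}"

lemma dense_D_trcl: "dense (D_trcl x)"
  unfolding dense_def
proof (intro allI impI)
  fix q assume c: "is_cond q"
  show "\<exists>q'. is_cond q' \<and> q' \<unlhd> q \<and> q' \<in> D_trcl x"
  proof (cases "trcl_in (fst q) x \<subseteq> ran (fst q)")
    case True
    then show ?thesis using c by (intro exI[of _ q]) (auto simp: D_trcl_def)
  next
    case False
    then obtain y where y: "y \<in> trcl_in (fst q) x" "y \<notin> ran (fst q)" by blast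
    then have "is_cond (fst q, insert y (snd q))"
      using c is_cond_insert_forbidden[of "fst q" "snd q" y] by simp
    then show ?thesis using y
      by (intro exI[of _ "(fst q, insert y (snd q))"]) (auto simp: extends_def D_trcl_def)
  qed
qed

lemma trcl_in_refl: "x \<in> trcl_in p x"
  by (simp add: trcl_in_def)

lemma trcl_in_step: "y \<in> trcl_in p x \<Longrightarrow> mem_in p z y \<Longrightarrow> z \<in> trcl_in p x"
  by (auto simp: trcl_in_def)

lemma codes_trcl_in:
  assumes "is_cond q" "codes (fst q) h n" "y \<in> trcl_in (fst q) n"
  shows "\<exists>x. codes (fst q) x y"
proof -
  have "(mem_in (fst q))\<^sup>*\<^sup>* y n" using assms(3) by (simp add: trcl_in_def)
  then show ?thesis
  proof (induction rule: converse_rtranclp_induct)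
    case (step y z)
    then show ?case using codes_mem[OF assms(1)] by blast
  qed (use assms(2) in blast)
qed

text \<open>A Mostowski collapse: a minimal number without a set would have only coded members, and
  would then code the set of what they code. Well-foundedness is assumed for arbitrary subsets here,
  not just for concepts.\<close>

lemma ex_codes:
  assumes c: "is_cond q" and ran: "trcl_in (fst q) x \<subseteq> ran (fst q)"
    and wf: "\<And>S. S \<subseteq> trcl_in (fst q) x \<Longrightarrow> S \<noteq> {} \<Longrightarrow> \<exists>y\<in>S. \<forall>z\<in>S. \<not> mem_in (fst q) z y"
  shows "\<exists>h. codes (fst q) h x"
proof (rule ccontr)
  assume contr: "\<not> ?thesis"
  define S where "S = {y \<in> trcl_in (fst q) x. \<not> (\<exists>h. codes (fst q) h y)}"
  have "x \<in> S" using contr by (simp add: S_def trcl_in_refl)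
  then obtain y where y: "y \<in> S" "\<And>z. z \<in> S \<Longrightarrow> \<not> mem_in (fst q) z y"
    using wf[of S] S_def by blast
  have "y \<in> ran (fst q)" using y(1) ran by (auto simp: S_def)
  then obtain X where X: "fst q X = Some y" by (auto simp: ran_def)
  have "\<exists>h. codes (fst q) h a" if "[a] \<in> X" for a
  proof -
    have "mem_in (fst q) a y" using X that by (auto simp: mem_in_def)
    moreover from this have "a \<in> trcl_in (fst q) x" using y(1) by (auto simp: S_def intro: trcl_in_step)
    ultimately show ?thesis using y(2)[of a] by (auto simp: S_def)
  qed
  then obtain f where f: "\<And>a. [a] \<in> X \<Longrightarrow> codes (fst q) (f a) a" by metis
  have "X \<in> dom (fst q)" using X by blast
  then have X1: "X \<subseteq> tuples UNIV 1" using c unfolding is_cond_def by blast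
  have "codes (fst q) (hset (f ` {a. [a] \<in> X})) y"
  proof (rule codes.intros[of "fst q" X, OF X])
    show "\<exists>a. codes (fst q) x a \<and> [a] \<in> X" if "x \<in> elems (hset (f ` {a. [a] \<in> X}))" for x
      using that f by auto
    show "\<exists>a. as = [a] \<and> (\<exists>x. x \<in> elems (hset (f ` {a. [a] \<in> X})) \<and> codes (fst q) x a)"
      if "as \<in> X" for as
    proof -
      have "length as = 1" using X1 that by (auto simp: tuples_UNIV)
      then obtain a where "as = [a]" by (auto simp: length_Suc_conv)
      then show ?thesis using that f by auto
    qed
  qed
  then show False using y(1) by (auto simp: S_def)
qed

subsection \<open>Elementary copies of the hereditarily countable sets\<close>

abbreviation hmem :: "hc \<Rightarrow> hc \<Rightarrow> bool" where
  "hmem x y \<equiv> x \<in> elems y"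

abbreviation hsat :: "(nat \<Rightarrow> hc) \<Rightarrow> sform \<Rightarrow> bool" where
  "hsat \<equiv> ssat UNIV hmem"

definition hparams :: "hc list \<Rightarrow> nat \<Rightarrow> hc" where
  "hparams hs i = (if i < length hs then hs ! i else hset {})"

fun sbound :: "sform \<Rightarrow> nat" where
  "sbound (SMem i j) = Suc (i + j)"
| "sbound (SEq i j) = Suc (i + j)"
| "sbound (SNeg p) = sbound p"
| "sbound (SConj p q) = sbound p + sbound q"
| "sbound (SEx i p) = sbound p"

lemma ssat_coincidence:
  "(\<And>i. i < sbound p \<Longrightarrow> e i = e' i) \<Longrightarrow> ssat D m e p \<longleftrightarrow> ssat D m e' p"
proof (induction p arbitrary: e e')
  case (SNeg p)
  then show ?case by (metis sbound.simps(3) ssat.simps(3))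
next
  case (SConj p q)
  have "ssat D m e p \<longleftrightarrow> ssat D m e' p"
    by (rule SConj.IH(1)) (simp add: SConj.prems)
  moreover have "ssat D m e q \<longleftrightarrow> ssat D m e' q"
    by (rule SConj.IH(2)) (simp add: SConj.prems)
  ultimately show ?case by simp
next
  case (SEx i p)
  have "ssat D m (e(i := a)) p \<longleftrightarrow> ssat D m (e'(i := a)) p" for a
    by (rule SEx.IH) (simp add: SEx.prems)
  then show ?case by simp
qed simp_all

lemma hparams_upd:
  "hsat (e(i := a)) p \<longleftrightarrow> hsat ((hparams (map e [0..<sbound p]))(i := a)) p"
  by (intro ssat_coincidence) (auto simp: hparams_def)

lemma hparams_upd2:
  "hsat (e(i := a, j := b)) p \<longleftrightarrow> hsat ((hparams (map e [0..<sbound p]))(i := a, j := b)) p"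
  by (intro ssat_coincidence) (auto simp: hparams_def)

text \<open>The singleton is written \<open>{a, a}\<close> to match \<open>is_upair D m a a\<close>
  in \<open>is_opair\<close>.\<close>

definition kpair :: "hc \<Rightarrow> hc \<Rightarrow> hc" where
  "kpair a b = hset {hset {a, a}, hset {a, b}}"

primrec hnat :: "nat \<Rightarrow> hc" where
  "hnat 0 = hset {}"
| "hnat (Suc n) = hset (insert (hnat n) (elems (hnat n)))"

text \<open>Every set in question is countable, so an enumeration well-orders it in type at most
  \<omega>.\<close>

definition horder :: "hc \<Rightarrow> hc" where
  "horder u = hset {kpair a b |a b. a \<in> elems u \<and> b \<in> elems u \<and>
     to_nat_on (elems u) a < to_nat_on (elems u) b}"

lemma hset_eq_iff: "countable A \<Longrightarrow> countable B \<Longrightarrow> hset A = hset B \<longleftrightarrow> A = B"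
  using elems_hset by fastforce

lemma kpair_inject [simp]: "kpair a b = kpair c d \<longleftrightarrow> a = c \<and> b = d"
proof -
  have doub: "hset {x, y} = hset {u, v} \<longleftrightarrow> x = u \<and> y = v \<or> x = v \<and> y = u" for x y u v
    by (simp add: hset_eq_iff doubleton_eq_iff)
  show ?thesis unfolding kpair_def doub by auto
qed

lemma elems_horder:
  "kpair a b \<in> elems (horder u) \<longleftrightarrow> a \<in> elems u \<and> b \<in> elems u \<and>
     to_nat_on (elems u) a < to_nat_on (elems u) b"
proof -
  define A where "A = {kpair a b |a b. a \<in> elems u \<and> b \<in> elems u \<and>
      to_nat_on (elems u) a < to_nat_on (elems u) b}"
  have "A \<subseteq> (\<lambda>(a, b). kpair a b) ` (elems u \<times> elems u)"
    unfolding A_def by auto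
  then have "countable A"
    by (rule countable_subset) (intro countable_image countable_SIGMA countable_elems)
  then have "elems (horder u) = A" unfolding horder_def A_def[symmetric] by (rule elems_hset)
  then have "kpair a b \<in> elems (horder u) \<longleftrightarrow> kpair a b \<in> A" by simp
  also have "\<dots> \<longleftrightarrow> a \<in> elems u \<and> b \<in> elems u \<and> to_nat_on (elems u) a < to_nat_on (elems u) b"
    unfolding A_def mem_Collect_eq kpair_inject by blast
  finally show ?thesis .
qed

text \<open>\<open>skolem\<close> is the Tarski-Vaught criterion. Separation and collection refer to
  truth among all hereditarily countable sets, which elementarity turns into truth in
  \<open>H\<close>; the remaining closure conditions provide the individual sets that the axioms ask
  for.\<close>

locale hc_submodel =
  fixes H :: "hc set"
  assumes transitive: "h \<in> H \<Longrightarrow> x \<in> elems h \<Longrightarrow> x \<in> H"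
    and skolem: "set hs \<subseteq> H \<Longrightarrow> hsat ((hparams hs)(i := a)) p \<Longrightarrow>
      \<exists>a\<in>H. hsat ((hparams hs)(i := a)) p"
    and pair: "a \<in> H \<Longrightarrow> b \<in> H \<Longrightarrow> hset {a, b} \<in> H"
    and union: "a \<in> H \<Longrightarrow> hset (\<Union>x\<in>elems a. elems x) \<in> H"
    and omega: "hset (range hnat) \<in> H"
    and separation: "set hs \<subseteq> H \<Longrightarrow> u \<in> H \<Longrightarrow>
      hset {a \<in> elems u. hsat ((hparams hs)(i := a)) p} \<in> H"
    and collection: "set hs \<subseteq> H \<Longrightarrow> u \<in> H \<Longrightarrow>
      (\<And>a. a \<in> elems u \<Longrightarrow> \<exists>b. hsat ((hparams hs)(i := a, j := b)) p) \<Longrightarrow>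
      \<exists>v\<in>H. \<forall>a\<in>elems u. \<exists>b\<in>elems v. hsat ((hparams hs)(i := a, j := b)) p"
    and order: "u \<in> H \<Longrightarrow> horder u \<in> H"

locale hc_copy = hc_submodel +
  fixes D :: "'a set" and m :: "'a \<Rightarrow> 'a \<Rightarrow> bool" and g :: "'a \<Rightarrow> hc"
  assumes inj: "inj_on g D" and onto: "g ` D = H"
    and mem: "a \<in> D \<Longrightarrow> b \<in> D \<Longrightarrow> m a b \<longleftrightarrow> g a \<in> elems (g b)"
begin

lemma gH: "a \<in> D \<Longrightarrow> g a \<in> H"
  using onto by auto

lemma ex_g: "h \<in> H \<Longrightarrow> \<exists>a\<in>D. g a = h"
  using onto by auto

lemma g_eq: "a \<in> D \<Longrightarrow> b \<in> D \<Longrightarrow> g a = g b \<longleftrightarrow> a = b"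
  using inj by (auto simp: inj_on_def)

lemma g_elems_eq:
  assumes "a \<in> D" "b \<in> D" "\<And>z. z \<in> D \<Longrightarrow> m z a \<longleftrightarrow> m z b"
  shows "elems (g a) = elems (g b)"
proof -
  have "elems (g c) = g ` {z \<in> D. m z c}" if "c \<in> D" for c
    using that mem transitive[OF gH[OF that]] ex_g by blast
  then show ?thesis using assms by auto
qed

text \<open>The Tarski-Vaught induction. At an existential quantifier the assignment is cut down to
  finitely many parameters, to which \<open>skolem\<close> applies.\<close>

lemma elementary: "(\<And>i. e i \<in> D) \<Longrightarrow> ssat D m e p \<longleftrightarrow> hsat (g \<circ> e) p"
proof (induction p arbitrary: e)
  case (SEx i p)
  have IH: "ssat D m (e(i := a)) p \<longleftrightarrow> hsat ((g \<circ> e)(i := g a)) p" if "a \<in> D" for a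
  proof -
    have "g \<circ> e(i := a) = (g \<circ> e)(i := g a)" by auto
    moreover have "ssat D m (e(i := a)) p \<longleftrightarrow> hsat (g \<circ> e(i := a)) p"
      by (rule SEx.IH) (simp add: SEx.prems that)
    ultimately show ?thesis by simp
  qed
  have "\<exists>a\<in>D. hsat ((g \<circ> e)(i := g a)) p" if a: "hsat ((g \<circ> e)(i := a)) p" for a
  proof -
    have "\<exists>h\<in>H. hsat ((g \<circ> e)(i := h)) p"
      using skolem[of "map (g \<circ> e) [0..<sbound p]" i a p] a SEx.prems
      unfolding hparams_upd[of "g \<circ> e"] by (auto simp: gH image_subset_iff)
    then show ?thesis using onto by auto
  qed
  then show ?case unfolding ssat.simps using IH by blast
qed (auto simp: mem g_eq)

lemma elementary_upd:
  assumes "\<And>i. e i \<in> D" "a \<in> D"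
  shows "ssat D m (e(i := a)) p \<longleftrightarrow> hsat ((hparams (map (g \<circ> e) [0..<sbound p]))(i := g a)) p"
proof -
  have "(e(i := a)) j \<in> D" for j using assms by simp
  then have "ssat D m (e(i := a)) p \<longleftrightarrow> hsat (g \<circ> e(i := a)) p" by (rule elementary)
  also have "g \<circ> e(i := a) = (g \<circ> e)(i := g a)" by auto
  finally show ?thesis unfolding hparams_upd[of "g \<circ> e" i "g a" p] .
qed

lemma elementary_upd2:
  assumes "\<And>i. e i \<in> D" "a \<in> D" "b \<in> D"
  shows "ssat D m (e(i := a, j := b)) p \<longleftrightarrow>
    hsat ((hparams (map (g \<circ> e) [0..<sbound p]))(i := g a, j := g b)) p"
proof -
  have "(e(i := a, j := b)) k \<in> D" for k using assms by simp
  then have "ssat D m (e(i := a, j := b)) p \<longleftrightarrow> hsat (g \<circ> e(i := a, j := b)) p" by (rule elementary)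
  also have "g \<circ> e(i := a, j := b) = (g \<circ> e)(i := g a, j := g b)" by auto
  finally show ?thesis unfolding hparams_upd2[of "g \<circ> e" i "g a" j "g b" p] .
qed

lemma params_H: "(\<And>i. e i \<in> D) \<Longrightarrow> set (map (g \<circ> e) [0..<k]) \<subseteq> H"
  using gH by auto

section \<open>The axioms of set theory in the copy\<close>

lemma extensionality: "zf_extensionality D m"
  unfolding zf_extensionality_def
proof (intro ballI impI)
  fix a b assume ab: "a \<in> D" "b \<in> D" "\<forall>z\<in>D. m z a = m z b"
  then have "elems (g a) = elems (g b)" by (intro g_elems_eq) auto
  then show "a = b" using hc_eqI[of "g a" "g b"] g_eq ab by simp
qed

lemma is_upair_iff:
  assumes "a \<in> D" "b \<in> D" "c \<in> D"
  shows "is_upair D m a b c \<longleftrightarrow> elems (g c) = {g a, g b}"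
proof
  assume u: "is_upair D m a b c"
  show "elems (g c) = {g a, g b}"
  proof (intro Set.set_eqI iffI)
    fix x assume "x \<in> elems (g c)"
    moreover from this obtain z where "z \<in> D" "g z = x"
      using transitive[OF gH[OF assms(3)]] ex_g by blast
    ultimately show "x \<in> {g a, g b}" using u assms by (auto simp: is_upair_def mem)
  next
    fix x assume "x \<in> {g a, g b}"
    then show "x \<in> elems (g c)" using u assms by (auto simp: is_upair_def mem)
  qed
qed (use assms in \<open>auto simp: is_upair_def mem g_eq\<close>)

lemma pairing: "zf_pairing D m"
  unfolding zf_pairing_def
proof (intro ballI)
  fix a b assume ab: "a \<in> D" "b \<in> D"
  then obtain c where "c \<in> D" "g c = hset {g a, g b}" using ex_g[OF pair, OF gH gH] by blast
  then show "\<exists>c\<in>D. is_upair D m a b c" using ab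
    by (intro bexI[of _ c]) (simp_all add: is_upair_iff)
qed

lemma unions: "zf_union D m"
  unfolding zf_union_def
proof
  fix a assume a: "a \<in> D"
  then obtain u where u: "u \<in> D" "g u = hset (\<Union>x\<in>elems (g a). elems x)"
    using ex_g[OF union, OF gH] by blast
  have "m z u \<longleftrightarrow> (\<exists>y\<in>D. m y a \<and> m z y)" if z: "z \<in> D" for z
  proof
    assume "m z u"
    then obtain x where x: "x \<in> elems (g a)" "g z \<in> elems x" using u z by (auto simp: mem)
    then obtain y where "y \<in> D" "g y = x" using transitive[OF gH[OF a]] ex_g by blast
    then show "\<exists>y\<in>D. m y a \<and> m z y" using x a z by (auto simp: mem)
  qed (use u a z in \<open>auto simp: mem\<close>)
  then show "\<exists>u\<in>D. \<forall>z\<in>D. m z u \<longleftrightarrow> (\<exists>y\<in>D. m y a \<and> m z y)" using u by blast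
qed

lemma infinity: "zf_infinity D m"
proof -
  obtain w where w: "w \<in> D" "g w = hset (range hnat)" using ex_g[OF omega] by blast
  have hn: "\<exists>s\<in>D. g s = hnat n" for n
    using transitive[OF omega, of "hnat n"] ex_g by auto
  obtain z where z: "z \<in> D" "g z = hnat 0" using hn by blast
  have "\<exists>s\<in>D. m s w \<and> (\<forall>z\<in>D. m z s \<longleftrightarrow> m z y \<or> z = y)" if y: "y \<in> D" "m y w" for y
  proof -
    obtain n where n: "g y = hnat n" using y w by (auto simp: mem)
    obtain s where "s \<in> D" and gs: "g s = hnat (Suc n)" using hn by blast
    then have s: "s \<in> D" "elems (g s) = insert (g y) (elems (g y))" by (simp_all add: n)
    moreover have "hnat (Suc n) \<in> range hnat" by (rule rangeI)
    ultimately have "m s w" using w gs by (simp add: mem del: hnat.simps)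
    then show ?thesis using y s by (intro bexI[of _ s]) (auto simp: mem g_eq)
  qed
  moreover have "m z w" using z w by (simp add: mem del: hnat.simps)
  moreover have "\<not> m x z" if "x \<in> D" for x using z that by (simp add: mem)
  ultimately show ?thesis unfolding zf_infinity_def using w(1) z(1) by blast
qed

lemma foundation: "zf_foundation D m"
  unfolding zf_foundation_def
proof (intro ballI impI)
  fix a assume a: "a \<in> D" "\<exists>y\<in>D. m y a"
  then obtain x where "x \<in> elems (g a)" by (auto simp: mem)
  then obtain y where y: "y \<in> elems (g a)" "\<And>z. z \<in> elems y \<Longrightarrow> z \<notin> elems (g a)"
    using wfE_min[OF wf_elems, of x "elems (g a)"] by auto
  then obtain b where "b \<in> D" "g b = y" using transitive[OF gH[OF a(1)]] ex_g by blast
  then show "\<exists>y\<in>D. m y a \<and> \<not> (\<exists>z\<in>D. m z a \<and> m z y)"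
    using y a(1) by (intro bexI[of _ b]) (auto simp: mem)
qed

lemma separation_schema: "zf_separation D m"
  unfolding zf_separation_def
proof (intro allI impI ballI)
  fix p x u and e :: "nat \<Rightarrow> 'a" assume e: "\<forall>i. e i \<in> D" and u: "u \<in> D"
  obtain v where v: "v \<in> D"
    "g v = hset {a \<in> elems (g u). hsat ((hparams (map (g \<circ> e) [0..<sbound p]))(x := a)) p}"
    using ex_g[OF separation[OF params_H gH[OF u]]] e by blast
  show "\<exists>v\<in>D. \<forall>a\<in>D. m a v \<longleftrightarrow> m a u \<and> ssat D m (e(x := a)) p"
    using v u e by (intro bexI[of _ v]) (auto simp: mem elementary_upd)
qed

lemma collection_schema: "zf_collection D m"
  unfolding zf_collection_def
proof (intro allI impI ballI)
  fix p x y u and e :: "nat \<Rightarrow> 'a"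
  assume e: "x \<noteq> y \<and> (\<forall>i. e i \<in> D)" and u: "u \<in> D"
    and ex: "\<forall>a\<in>D. \<exists>b\<in>D. ssat D m (e(x := a, y := b)) p"
  define hs where "hs = map (g \<circ> e) [0..<sbound p]"
  have "\<exists>b. hsat ((hparams hs)(x := a, y := b)) p" if a: "a \<in> elems (g u)" for a
  proof -
    obtain a' where a': "a' \<in> D" "g a' = a" using a transitive[OF gH[OF u]] ex_g by blast
    then obtain b where "b \<in> D" "ssat D m (e(x := a', y := b)) p" using ex by blast
    then show ?thesis using a' e elementary_upd2[of e a' b x y p] by (auto simp: hs_def)
  qed
  moreover have "set hs \<subseteq> H" using params_H e by (simp add: hs_def)
  ultimately have "\<exists>v\<in>H. \<forall>a\<in>elems (g u). \<exists>b\<in>elems v. hsat ((hparams hs)(x := a, y := b)) p"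
    by (intro collection gH[OF u])
  then obtain v where v: "v \<in> D" "\<forall>a\<in>elems (g u). \<exists>b\<in>elems (g v). hsat ((hparams hs)(x := a, y := b)) p"
    using ex_g by blast
  have "\<exists>b\<in>D. m b v \<and> ssat D m (e(x := a, y := b)) p" if a: "a \<in> D" "m a u" for a
  proof -
    obtain b where b: "b \<in> elems (g v)" "hsat ((hparams hs)(x := g a, y := b)) p"
      using v(2) a u by (auto simp: mem)
    then obtain b' where "b' \<in> D" "g b' = b" using transitive[OF gH[OF v(1)]] ex_g by blast
    then show ?thesis using b a(1) v(1) e elementary_upd2[of e a b' x y p]
      by (intro bexI[of _ b']) (auto simp: hs_def mem)
  qed
  then show "\<exists>v\<in>D. \<forall>a\<in>D. m a u \<longrightarrow> (\<exists>b\<in>D. m b v \<and> ssat D m (e(x := a, y := b)) p)"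
    using v(1) by blast
qed

lemma is_opair_iff:
  assumes "a \<in> D" "b \<in> D" "c \<in> D"
  shows "is_opair D m a b c \<longleftrightarrow> g c = kpair (g a) (g b)"
proof
  assume "is_opair D m a b c"
  then obtain s t where st: "s \<in> D" "t \<in> D" "is_upair D m a a s" "is_upair D m a b t" "is_upair D m s t c"
    by (auto simp: is_opair_def)
  then have "g s = hset {g a, g a}" "g t = hset {g a, g b}"
    using assms by (auto simp: is_upair_iff intro: hc_eqI)
  then show "g c = kpair (g a) (g b)" using st assms
    by (auto simp: is_upair_iff kpair_def intro: hc_eqI)
next
  assume c: "g c = kpair (g a) (g b)"
  obtain s t where "s \<in> D" "g s = hset {g a, g a}" "t \<in> D" "g t = hset {g a, g b}"
    using ex_g[OF pair] gH assms by metis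
  moreover from this have "is_upair D m a a s" "is_upair D m a b t" "is_upair D m s t c"
    using c assms by (simp_all add: is_upair_iff kpair_def)
  ultimately show "is_opair D m a b c" by (auto simp: is_opair_def)
qed

lemma related_by_iff:
  assumes "a \<in> D" "b \<in> D" "r \<in> D"
  shows "related_by D m r a b \<longleftrightarrow> kpair (g a) (g b) \<in> elems (g r)"
proof
  assume "related_by D m r a b"
  then show "kpair (g a) (g b) \<in> elems (g r)" using assms
    by (auto simp: related_by_def is_opair_iff mem)
next
  assume k: "kpair (g a) (g b) \<in> elems (g r)"
  then obtain c where "c \<in> D" "g c = kpair (g a) (g b)"
    using transitive[OF gH[OF assms(3)]] ex_g by blast
  then show "related_by D m r a b" using assms k
    by (auto simp: related_by_def is_opair_iff mem)
qed

lemma well_ordering: "zf_well_ordering D m"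
  unfolding zf_well_ordering_def
proof
  fix u assume u: "u \<in> D"
  then obtain r where r: "r \<in> D" "g r = horder (g u)" using ex_g[OF order, OF gH] by blast
  define f where "f a = to_nat_on (elems (g u)) (g a)" for a
  have rel: "related_by D m r a b \<longleftrightarrow> m a u \<and> m b u \<and> f a < f b" if "a \<in> D" "b \<in> D" for a b
    using that u r by (simp add: related_by_iff elems_horder mem f_def)
  have f: "f a = f b \<longleftrightarrow> a = b" if "a \<in> D" "b \<in> D" "m a u" "m b u" for a b
    using that u by (simp add: f_def mem g_eq)
  have least: "\<exists>a\<in>D. m a s \<and> (\<forall>b\<in>D. m b s \<longrightarrow> \<not> related_by D m r b a)"
    if s: "s \<in> D" "\<exists>z\<in>D. m z s" for s
  proof -
    obtain z where z: "z \<in> D" "m z s" using s by blast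
    define a where "a = (ARG_MIN f x. x \<in> D \<and> m x s)"
    have a: "a \<in> D \<and> m a s"
      unfolding a_def by (rule arg_min_natI[of _ z]) (simp add: z)
    have "f a \<le> f b" if "b \<in> D" "m b s" for b
      unfolding a_def by (rule arg_min_nat_le) (simp add: that)
    then have "\<forall>b\<in>D. m b s \<longrightarrow> \<not> related_by D m r b a"
      using rel a by (auto simp: linorder_not_less)
    then show ?thesis using a by blast
  qed
  have "well_orders D m r u"
    unfolding well_orders_def
  proof (intro conjI ballI impI)
    show "\<not> related_by D m r a a" if "a \<in> D" for a
      using that by (simp add: rel)
    show "related_by D m r a c" if "a \<in> D" "b \<in> D" "c \<in> D" "m a u \<and> m b u \<and> m c u \<and>
        related_by D m r a b \<and> related_by D m r b c" for a b c
      using that by (auto simp: rel)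
    show "related_by D m r a b \<or> a = b \<or> related_by D m r b a"
      if "a \<in> D" "b \<in> D" "m a u \<and> m b u" for a b
      using that rel[of a b] rel[of b a] f[of a b] by (auto simp: linorder_neq_iff)
    show "\<exists>a\<in>D. m a s \<and> (\<forall>b\<in>D. m b s \<longrightarrow> \<not> related_by D m r b a)"
      if "s \<in> D" "(\<forall>z\<in>D. m z s \<longrightarrow> m z u) \<and> (\<exists>z\<in>D. m z s)" for s
      using least[of s] that by blast
  qed
  then show "\<exists>r\<in>D. well_orders D m r u" using r by blast
qed

theorem model_ZFC_minus_P: "model_ZFC_minus_P D m"
  unfolding model_ZFC_minus_P_def
  using extensionality pairing unions infinity separation_schema collection_schema foundation
    well_ordering by blast

end

subsection \<open>A countable hull\<close>

text \<open>Concepts, conditions and sets share one type because the closure conditions mix them: a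
  condition and a formula determine a concept, a condition and a number a set.\<close>

datatype item = IC (the_conc: conc) | IP (the_cond: cond) | IH (the_hc: hc)

text \<open>A query carries the finite data of a request, such as formulas, variables and numbers,
  and so remains countable; infinite parameters are passed as items.\<close>

datatype query =
    QStart | QEmpty | QCov nat | QChoice form "nat list" nat nat "nat list" | QCode | QTrcl nat
  | QComp form "nat list" "nat list" | QChosen form "nat list" nat nat "nat list"
  | QSkolem form nat nat "nat list" | QSect "nat list" | QPre nat | QTrclConc nat | QNonwf nat
  | QCollapse nat
  | QHSkolem sform nat | QElem nat | QPair | QUnion | QOmega | QSep sform nat
  | QColl sform nat nat | QOrder

instance query :: countable by countable_datatype

definition unary :: "nat set \<Rightarrow> conc" where
  "unary S = (\<lambda>a. [a]) ` S"

text \<open>The relations under which the hull is closed: whenever some item is related to given items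
  of the hull, some item of the hull is.\<close>

inductive wit :: "query \<Rightarrow> item list \<Rightarrow> item \<Rightarrow> bool" where
  "wit QStart [] (IP (Map.empty, {}))"
| "wit QEmpty [] (IC {})"
| "is_cond q' \<Longrightarrow> q' \<unlhd> q \<Longrightarrow> q' \<in> D_cov n R \<Longrightarrow> wit (QCov n) [IP q, IC R] (IP q')"
| "is_cond q' \<Longrightarrow> q' \<unlhd> q \<Longrightarrow> q' \<in> D_choice \<phi> xs m i (obj_params es) (conc_params Rs) \<Longrightarrow>
    wit (QChoice \<phi> xs m i es) (IP q # map IC Rs) (IP q')"
| "is_cond q' \<Longrightarrow> q' \<unlhd> q \<Longrightarrow> q' \<in> D_code h \<Longrightarrow> wit QCode [IP q, IH h] (IP q')"
| "is_cond q' \<Longrightarrow> q' \<unlhd> q \<Longrightarrow> q' \<in> D_trcl x \<Longrightarrow> wit (QTrcl x) [IP q] (IP q')"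
| "R = {as \<in> tuples UNIV (length xs). sat (PStr (fst q)) (upd_tuple (obj_params es) xs as) (conc_params Rs) \<phi>} \<Longrightarrow>
    wit (QComp \<phi> xs es) (IP q # map IC Rs) (IC R)"
| "R \<in> Cov (fst q) (length xs + m) \<Longrightarrow>
    \<forall>as\<in>tuples UNIV (length xs). sat (PStr (fst q)) (upd_tuple (obj_params es) xs as)
      (upd_conc (conc_params Rs) m i (section_at R as)) \<phi> \<Longrightarrow>
    wit (QChosen \<phi> xs m i es) (IP q # map IC Rs) (IC R)"
| "X \<in> Cov (fst q) n \<Longrightarrow> sat (PStr (fst q)) (obj_params es) (upd_conc (conc_params Rs) n i X) \<phi> \<Longrightarrow>
    wit (QSkolem \<phi> n i es) (IP q # map IC Rs) (IC X)"
| "wit (QSect as) [IC R] (IC (section_at R as))"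
| "fst q X = Some n \<Longrightarrow> wit (QPre n) [IP q] (IC X)"
| "wit (QTrclConc x) [IP q] (IC (unary (trcl_in (fst q) x)))"
| "S \<subseteq> trcl_in (fst q) x \<Longrightarrow> S \<noteq> {} \<Longrightarrow> \<forall>y\<in>S. \<exists>z\<in>S. mem_in (fst q) z y \<Longrightarrow>
    wit (QNonwf x) [IP q] (IC (unary S))"
| "codes (fst q) h x \<Longrightarrow> wit (QCollapse x) [IP q] (IH h)"
| "hsat ((hparams hs)(i := a)) p \<Longrightarrow> wit (QHSkolem p i) (map IH hs) (IH a)"
| "elems h \<noteq> {} \<Longrightarrow> wit (QElem n) [IH h] (IH (from_nat_into (elems h) n))"
| "wit QPair [IH a, IH b] (IH (hset {a, b}))"
| "wit QUnion [IH a] (IH (hset (\<Union>x\<in>elems a. elems x)))"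
| "wit QOmega [] (IH (hset (range hnat)))"
| "wit (QSep p i) (IH u # map IH hs) (IH (hset {a \<in> elems u. hsat ((hparams hs)(i := a)) p}))"
| "\<forall>a\<in>elems u. \<exists>b\<in>elems v. hsat ((hparams hs)(i := a, j := b)) p \<Longrightarrow>
    wit (QColl p i j) (IH u # map IH hs) (IH v)"
| "wit QOrder [IH u] (IH (horder u))"

lemma map_IC_eq [simp]: "map IC Rs = map IC Rs' \<longleftrightarrow> Rs = Rs'"
  by (rule inj_map_eq_map) (simp add: inj_def)

lemma map_IH_eq [simp]: "map IH hs = map IH hs' \<longleftrightarrow> hs = hs'"
  by (rule inj_map_eq_map) (simp add: inj_def)

locale hull =
  fixes N :: "item set"
  assumes countable_N: "countable N"
    and closed: "set xs \<subseteq> N \<Longrightarrow> wit k xs y \<Longrightarrow> \<exists>y\<in>N. wit k xs y"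
begin

definition NC :: "conc set" where "NC = {X. IC X \<in> N}"
definition NP :: "cond set" where "NP = {q. IP q \<in> N \<and> is_cond q}"
definition NH :: "hc set" where "NH = {h. IH h \<in> N}"

lemma countable_NC: "countable NC"
  and countable_NH: "countable NH"
proof -
  have "NC \<subseteq> the_conc ` N" "NH \<subseteq> the_hc ` N"
    by (force simp: NC_def image_iff, force simp: NH_def image_iff)
  then show "countable NC" "countable NH"
    using countable_N by (meson countable_image countable_subset)+
qed

lemma map_IC_N: "set Rs \<subseteq> NC \<Longrightarrow> set (map IC Rs) \<subseteq> N"
  by (auto simp: NC_def)

lemma map_IH_N: "set hs \<subseteq> NH \<Longrightarrow> set (map IH hs) \<subseteq> N"
  by (auto simp: NH_def)

lemma start_NP: "(Map.empty, {}) \<in> NP"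
proof -
  obtain y where "y \<in> N" "wit QStart [] y" using closed[OF _ wit.intros(1)] by auto
  then show ?thesis by (auto elim: wit.cases simp: NP_def is_cond_def)
qed

lemma empty_NC: "{} \<in> NC"
proof -
  obtain y where "y \<in> N" "wit QEmpty [] y" using closed[OF _ wit.intros(2)] by auto
  then show ?thesis by (auto elim: wit.cases simp: NC_def)
qed

text \<open>Density speaks about all conditions. It supplies one answer to the query, closure then
  supplies an answer in the hull, and \<open>inv\<close> recovers from this answer that it is a
  condition in \<open>D\<close>.\<close>

lemma dense_NP:
  assumes q: "q \<in> NP" and D: "dense D"
    and wit: "\<And>q'. is_cond q' \<Longrightarrow> q' \<unlhd> q \<Longrightarrow> q' \<in> D \<Longrightarrow> wit k (IP q # zs) (IP q')"
    and inv: "\<And>y. wit k (IP q # zs) y \<Longrightarrow> \<exists>q'. y = IP q' \<and> is_cond q' \<and> q' \<unlhd> q \<and> q' \<in> D"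
    and zs: "set zs \<subseteq> N"
  shows "\<exists>q'\<in>NP. q' \<unlhd> q \<and> q' \<in> D"
proof -
  obtain q' where "is_cond q'" "q' \<unlhd> q" "q' \<in> D" using D q unfolding dense_def NP_def by blast
  then have "wit k (IP q # zs) (IP q')" by (rule wit)
  moreover have "set (IP q # zs) \<subseteq> N" using q zs by (simp add: NP_def)
  ultimately obtain y where y: "y \<in> N" "wit k (IP q # zs) y" using closed by blast
  then obtain q' where "y = IP q'" "is_cond q'" "q' \<unlhd> q" "q' \<in> D" using inv by blast
  then show ?thesis using y(1) unfolding NP_def by blast
qed

lemma cov_NP:
  assumes "q \<in> NP" "R \<in> NC" "n \<ge> 1" "R \<subseteq> tuples UNIV n"
  shows "\<exists>q'\<in>NP. q' \<unlhd> q \<and> q' \<in> D_cov n R"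
proof (rule dense_NP[OF assms(1) dense_D_cov[OF assms(3,4)]])
  show "wit (QCov n) [IP q, IC R] (IP q')" if "is_cond q'" "q' \<unlhd> q" "q' \<in> D_cov n R" for q'
    using that by (rule wit.intros)
qed (use assms(2) in \<open>auto elim: wit.cases simp: NC_def\<close>)

lemma choice_NP:
  assumes "q \<in> NP" "set Rs \<subseteq> NC" "wf_form \<phi>" "sigma11 \<phi>" "m \<ge> 1"
    "\<And>n i. n \<ge> 1 \<Longrightarrow> conc_params Rs n i \<subseteq> tuples UNIV n"
  shows "\<exists>q'\<in>NP. q' \<unlhd> q \<and> q' \<in> D_choice \<phi> xs m i (obj_params es) (conc_params Rs)"
proof (rule dense_NP[OF assms(1) dense_D_choice])
  show "wit (QChoice \<phi> xs m i es) (IP q # map IC Rs) (IP q')"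
    if "is_cond q'" "q' \<unlhd> q" "q' \<in> D_choice \<phi> xs m i (obj_params es) (conc_params Rs)" for q'
    using that by (rule wit.intros)
  show "set (map IC Rs) \<subseteq> N" using assms(2) by (rule map_IC_N)
qed (use assms in \<open>auto elim: wit.cases\<close>)

lemma code_NP:
  assumes "q \<in> NP" "h \<in> NH"
  shows "\<exists>q'\<in>NP. q' \<unlhd> q \<and> q' \<in> D_code h"
proof (rule dense_NP[OF assms(1) dense_D_code])
  show "wit QCode [IP q, IH h] (IP q')" if "is_cond q'" "q' \<unlhd> q" "q' \<in> D_code h" for q'
    using that by (rule wit.intros)
qed (use assms(2) in \<open>auto elim: wit.cases simp: NH_def\<close>)

lemma trcl_NP:
  assumes "q \<in> NP"
  shows "\<exists>q'\<in>NP. q' \<unlhd> q \<and> q' \<in> D_trcl x"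
proof (rule dense_NP[OF assms(1) dense_D_trcl])
  show "wit (QTrcl x) [IP q] (IP q')" if "is_cond q'" "q' \<unlhd> q" "q' \<in> D_trcl x" for q'
    using that by (rule wit.intros)
qed (auto elim: wit.cases)

lemma closed_IP:
  assumes "q \<in> NP" "set zs \<subseteq> N" "wit k (IP q # zs) y"
  obtains y where "y \<in> N" "wit k (IP q # zs) y"
proof -
  have "set (IP q # zs) \<subseteq> N" using assms by (simp add: NP_def)
  then show thesis using closed[OF _ assms(3)] that by blast
qed

lemma comp_NC:
  assumes "q \<in> NP" "set Rs \<subseteq> NC"
  shows "{as \<in> tuples UNIV (length xs).
    sat (PStr (fst q)) (upd_tuple (obj_params es) xs as) (conc_params Rs) \<phi>} \<in> NC"
proof -
  obtain y where "y \<in> N" "wit (QComp \<phi> xs es) (IP q # map IC Rs) y"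
    using closed_IP[OF assms(1) map_IC_N[OF assms(2)] wit.intros(7)[OF refl]] by blast
  then show ?thesis by (auto elim: wit.cases simp: NC_def)
qed

lemma chosen_NC:
  assumes "q \<in> NP" "set Rs \<subseteq> NC" "R \<in> Cov (fst q) (length xs + m)"
    "\<forall>as\<in>tuples UNIV (length xs). sat (PStr (fst q)) (upd_tuple (obj_params es) xs as)
      (upd_conc (conc_params Rs) m i (section_at R as)) \<phi>"
  shows "\<exists>R\<in>NC. R \<in> Cov (fst q) (length xs + m) \<and>
    (\<forall>as\<in>tuples UNIV (length xs). sat (PStr (fst q)) (upd_tuple (obj_params es) xs as)
      (upd_conc (conc_params Rs) m i (section_at R as)) \<phi>)"
proof -
  obtain y where "y \<in> N" "wit (QChosen \<phi> xs m i es) (IP q # map IC Rs) y"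
    using closed_IP[OF assms(1) map_IC_N[OF assms(2)] wit.intros(8)[OF assms(3,4)]] by blast
  from this(2,1) show ?thesis by cases (auto simp: NC_def)
qed

text \<open>A covered witness may lie outside the hull. It is exchanged for one inside, which is a
  concept of the final model.\<close>

lemma skolem_NC:
  assumes "q \<in> NP" "set Rs \<subseteq> NC" "X \<in> Cov (fst q) n"
    "sat (PStr (fst q)) (obj_params es) (upd_conc (conc_params Rs) n i X) \<phi>"
  shows "\<exists>X\<in>NC. X \<in> Cov (fst q) n \<and>
    sat (PStr (fst q)) (obj_params es) (upd_conc (conc_params Rs) n i X) \<phi>"
proof -
  obtain y where "y \<in> N" "wit (QSkolem \<phi> n i es) (IP q # map IC Rs) y"
    using closed_IP[OF assms(1) map_IC_N[OF assms(2)] wit.intros(9)[OF assms(3,4)]] by blast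
  from this(2,1) show ?thesis by cases (auto simp: NC_def)
qed

lemma section_NC:
  assumes "R \<in> NC"
  shows "section_at R as \<in> NC"
proof -
  have "set [IC R] \<subseteq> N" using assms by (simp add: NC_def)
  then obtain y where "y \<in> N" "wit (QSect as) [IC R] y"
    using closed wit.intros(10) by blast
  then show ?thesis by (auto elim: wit.cases simp: NC_def)
qed

text \<open>Injectivity leaves the query a single answer, so the hull must contain it: every concept
  given a value by a condition in \<open>NP\<close> is a concept of the model.\<close>

lemma pre_NC:
  assumes "q \<in> NP" "fst q X = Some n"
  shows "X \<in> NC"
proof -
  obtain y where "y \<in> N" "wit (QPre n) [IP q] y"
    using closed_IP[OF assms(1) _ wit.intros(11)[of q, OF assms(2)]] by auto
  from this(2,1) show ?thesis
    using assoc_inj[of q] assms by cases (auto simp: NC_def NP_def)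
qed

lemma trcl_NC:
  assumes "q \<in> NP"
  shows "unary (trcl_in (fst q) x) \<in> NC"
proof -
  obtain y where "y \<in> N" "wit (QTrclConc x) [IP q] y"
    using closed_IP[OF assms(1) _ wit.intros(12)] by auto
  then show ?thesis by (auto elim: wit.cases simp: NC_def)
qed

text \<open>True ill-foundedness becomes visible to the model: some set without a minimal element is
  represented by a concept in the hull.\<close>

lemma nonwf_NC:
  assumes "q \<in> NP" "S \<subseteq> trcl_in (fst q) x" "S \<noteq> {}" "\<forall>y\<in>S. \<exists>z\<in>S. mem_in (fst q) z y"
  shows "\<exists>S. S \<subseteq> trcl_in (fst q) x \<and> S \<noteq> {} \<and> (\<forall>y\<in>S. \<exists>z\<in>S. mem_in (fst q) z y) \<and> unary S \<in> NC"
proof -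
  obtain y where "y \<in> N" "wit (QNonwf x) [IP q] y"
    using closed_IP[OF assms(1) _ wit.intros(13)[of _ q, OF assms(2-4)]] by auto
  from this(2,1) show ?thesis by cases (auto simp: NC_def)
qed

lemma collapse_NH:
  assumes "q \<in> NP" "codes (fst q) h x"
  shows "h \<in> NH"
proof -
  obtain y where "y \<in> N" "wit (QCollapse x) [IP q] y"
    using closed_IP[OF assms(1) _ wit.intros(14)[of q, OF assms(2)]] by auto
  from this(2,1) show ?thesis
    using codes_unique_set[of q] assms by cases (auto simp: NH_def NP_def)
qed

lemma hc_submodel: "hc_submodel NH"
proof
  show "x \<in> NH" if h: "h \<in> NH" and x: "x \<in> elems h" for h x
  proof -
    \<comment> \<open>Countability gives transitivity: each element is the \<open>n\<close>-th one
      for some \<open>n\<close>, and the query names \<open>n\<close>.\<close>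
    obtain n where n: "x = from_nat_into (elems h) n"
      using from_nat_into_surj[OF countable_elems x] by metis
    have "set [IH h] \<subseteq> N" "elems h \<noteq> {}" using h x by (auto simp: NH_def)
    then obtain y where "y \<in> N" "wit (QElem n) [IH h] y"
      using closed wit.intros(16) by blast
    from this(2,1) show ?thesis using n by cases (auto simp: NH_def)
  qed
  show "\<exists>a\<in>NH. hsat ((hparams hs)(i := a)) p" if hs: "set hs \<subseteq> NH" "hsat ((hparams hs)(i := a)) p" for hs i a p
  proof -
    obtain y where "y \<in> N" "wit (QHSkolem p i) (map IH hs) y"
      using closed[OF map_IH_N[OF hs(1)] wit.intros(15)[OF hs(2)]] by blast
    from this(2,1) show ?thesis by cases (auto simp: NH_def)
  qed
  show "hset {a, b} \<in> NH" if "a \<in> NH" "b \<in> NH" for a b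
  proof -
    have "set [IH a, IH b] \<subseteq> N" using that by (auto simp: NH_def)
    then obtain y where "y \<in> N" "wit QPair [IH a, IH b] y"
      using closed wit.intros(17) by blast
    from this(2,1) show ?thesis by cases (auto simp: NH_def)
  qed
  show "hset (\<Union>x\<in>elems a. elems x) \<in> NH" if "a \<in> NH" for a
  proof -
    have "set [IH a] \<subseteq> N" using that by (auto simp: NH_def)
    then obtain y where "y \<in> N" "wit QUnion [IH a] y"
      using closed wit.intros(18) by blast
    from this(2,1) show ?thesis by cases (auto simp: NH_def)
  qed
  show "hset (range hnat) \<in> NH"
  proof -
    obtain y where "y \<in> N" "wit QOmega [] y" using closed[OF _ wit.intros(19)] by auto
    from this(2,1) show ?thesis by cases (auto simp: NH_def)
  qed
  show "hset {a \<in> elems u. hsat ((hparams hs)(i := a)) p} \<in> NH" if "set hs \<subseteq> NH" "u \<in> NH" for hs u i p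
  proof -
    have "set (IH u # map IH hs) \<subseteq> N" using that by (auto simp: NH_def)
    then obtain y where "y \<in> N" "wit (QSep p i) (IH u # map IH hs) y"
      using closed wit.intros(20) by blast
    from this(2,1) show ?thesis by cases (auto simp: NH_def)
  qed
  show "\<exists>v\<in>NH. \<forall>a\<in>elems u. \<exists>b\<in>elems v. hsat ((hparams hs)(i := a, j := b)) p"
    if "set hs \<subseteq> NH" "u \<in> NH" and ex: "\<And>a. a \<in> elems u \<Longrightarrow> \<exists>b. hsat ((hparams hs)(i := a, j := b)) p"
    for hs u i j p
  proof -
    have "set (IH u # map IH hs) \<subseteq> N" using that by (auto simp: NH_def)
    \<comment> \<open>Among all hereditarily countable sets collection is immediate, as the image of
      \<open>elems u\<close> under a choice function is countable. So the query has an answer, and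
      hence one in the hull.\<close>
    moreover obtain f where f: "\<And>a. a \<in> elems u \<Longrightarrow> hsat ((hparams hs)(i := a, j := f a)) p"
      using ex by metis
    then have "\<forall>a\<in>elems u. \<exists>b\<in>elems (hset (f ` elems u)). hsat ((hparams hs)(i := a, j := b)) p"
      by auto
    ultimately obtain y where "y \<in> N" "wit (QColl p i j) (IH u # map IH hs) y"
      using closed wit.intros(21) by blast
    from this(2,1) show ?thesis by cases (auto simp: NH_def)
  qed
  show "horder u \<in> NH" if "u \<in> NH" for u
  proof -
    have "set [IH u] \<subseteq> N" using that by (auto simp: NH_def)
    then obtain y where "y \<in> N" "wit QOrder [IH u] y"
      using closed wit.intros(22) by blast
    from this(2,1) show ?thesis by cases (auto simp: NH_def)
  qed
qed

end

lemma hull_exists: "\<exists>N. hull N"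
  using countable_hull[of wit] by (metis hull.intro)

subsection \<open>The generic model\<close>

locale generic = hull +
  fixes G :: "nat \<Rightarrow> cond"
  assumes G_NP: "G k \<in> NP" and G_Suc: "G (Suc k) \<unlhd> G k"
    and meets_cov: "R \<in> NC \<Longrightarrow> n \<ge> 1 \<Longrightarrow> R \<subseteq> tuples UNIV n \<Longrightarrow> \<exists>k. G k \<in> D_cov n R"
    and meets_choice: "set Rs \<subseteq> NC \<Longrightarrow> wf_form \<phi> \<Longrightarrow> sigma11 \<phi> \<Longrightarrow> m \<ge> 1 \<Longrightarrow>
      (\<And>n i. n \<ge> 1 \<Longrightarrow> conc_params Rs n i \<subseteq> tuples UNIV n) \<Longrightarrow>
      \<exists>k. G k \<in> D_choice \<phi> xs m i (obj_params es) (conc_params Rs)"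
    and meets_code: "h \<in> NH \<Longrightarrow> \<exists>k. G k \<in> D_code h"
    and meets_trcl: "\<exists>k. G k \<in> D_trcl x"

lemma (in hull) generic_exists: "\<exists>G. generic N G"
proof -
  define A where "A = (\<lambda>(n, R). D_cov n R) ` {(n, R) \<in> UNIV \<times> NC. n \<ge> 1 \<and> R \<subseteq> tuples UNIV n}"
  define B where "B = (\<lambda>((\<phi>, xs, m, i, es), Rs). D_choice \<phi> xs m i (obj_params es) (conc_params Rs)) `
    {((\<phi>, xs, m, i, es), Rs) \<in> UNIV \<times> lists NC. wf_form \<phi> \<and> sigma11 \<phi> \<and> m \<ge> 1 \<and>
      (\<forall>n\<ge>1. \<forall>i. conc_params Rs n i \<subseteq> tuples UNIV n)}"
  define \<D> where "\<D> = A \<union> B \<union> D_code ` NH \<union> range D_trcl"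
  have "countable ((UNIV :: nat set) \<times> NC)" using countable_NC by simp
  then have "countable A" unfolding A_def by (intro countable_image countable_subset[OF _ \<open>countable (UNIV \<times> NC)\<close>]) auto
  moreover have "countable ((UNIV :: (form \<times> nat list \<times> nat \<times> nat \<times> nat list) set) \<times> lists NC)"
    using countable_NC by simp
  then have "countable B" unfolding B_def
    by (intro countable_image) (erule countable_subset[rotated], blast)
  ultimately have "countable \<D>" using countable_NH by (simp add: \<D>_def)
  moreover have "\<D> \<noteq> {}" "NP \<noteq> {}" using start_NP by (auto simp: \<D>_def)
  moreover have "\<exists>q'\<in>NP. q' \<unlhd> q \<and> q' \<in> D" if D: "D \<in> \<D>" and q: "q \<in> NP" for D q
  proof -
    from D consider "D \<in> A" | "D \<in> B" | h where "h \<in> NH" "D = D_code h" | x where "D = D_trcl x"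
      by (auto simp: \<D>_def)
    then show ?thesis
    proof cases
      case 1
      then show ?thesis using cov_NP[OF q] by (auto simp: A_def)
    next
      case 2
      then obtain \<phi> xs m i es Rs where "D = D_choice \<phi> xs m i (obj_params es) (conc_params Rs)"
        "\<forall>X\<in>set Rs. X \<in> NC" "wf_form \<phi>" "sigma11 \<phi>" "m \<ge> 1"
        "\<forall>n\<ge>1. \<forall>i. conc_params Rs n i \<subseteq> tuples UNIV n"
        by (auto simp: B_def)
      then show ?thesis using choice_NP[OF q, of Rs \<phi> m xs i es] by (auto simp: subset_iff)
    next
      case 3
      then show ?thesis using code_NP[OF q] by simp
    next
      case 4
      then show ?thesis using trcl_NP[OF q] by simp
    qed
  qed
  ultimately obtain G where G: "\<forall>k. G k \<in> NP" "\<forall>k. G (Suc k) \<unlhd> G k" "\<forall>D\<in>\<D>. \<exists>k. G k \<in> D"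
    using rasiowa_sikorski[of \<D> NP] by blast
  have "generic N G"
  proof
    show "G k \<in> NP" "G (Suc k) \<unlhd> G k" for k using G by auto
    show "\<exists>k. G k \<in> D_cov n R" if "R \<in> NC" "n \<ge> 1" "R \<subseteq> tuples UNIV n" for R n
    proof -
      have "D_cov n R \<in> A" using that by (auto simp: A_def intro!: image_eqI[of _ _ "(n, R)"])
      then show ?thesis using G(3) by (simp add: \<D>_def)
    qed
    show "\<exists>k. G k \<in> D_choice \<phi> xs m i (obj_params es) (conc_params Rs)"
      if "set Rs \<subseteq> NC" "wf_form \<phi>" "sigma11 \<phi>" "m \<ge> 1"
        "\<And>n i. n \<ge> 1 \<Longrightarrow> conc_params Rs n i \<subseteq> tuples UNIV n" for Rs \<phi> m xs i es
    proof -
      have "D_choice \<phi> xs m i (obj_params es) (conc_params Rs) \<in> B"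
        unfolding B_def by (rule image_eqI[of _ _ "((\<phi>, xs, m, i, es), Rs)"]) (use that in auto)
      then show ?thesis using G(3) by (simp add: \<D>_def)
    qed
    show "\<exists>k. G k \<in> D_code h" if "h \<in> NH" for h using G(3) that by (simp add: \<D>_def)
    show "\<exists>k. G k \<in> D_trcl x" for x using G(3) by (simp add: \<D>_def)
  qed
  then show ?thesis by blast
qed

context generic
begin

abbreviation p :: "nat \<Rightarrow> assoc" where
  "p k \<equiv> fst (G k)"

lemma G_cond: "is_cond (G k)"
  using G_NP by (simp add: NP_def)

lemma G_le: "k \<le> l \<Longrightarrow> G l \<unlhd> G k"
proof (induction rule: dec_induct)
  case (step n)
  show ?case by (rule extends_trans[OF G_Suc step.IH])
qed simp

lemma p_le: "k \<le> l \<Longrightarrow> p k \<subseteq>\<^sub>m p l"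
  using G_le by (simp add: extends_def)

definition asc :: assoc where
  "asc = ch_union p"

lemma asc_Some: "asc X = Some n \<longleftrightarrow> (\<exists>k. p k X = Some n)"
  unfolding asc_def by (rule ch_union_Some) (simp add: p_le)

lemma p_le_asc: "p k \<subseteq>\<^sub>m asc"
  unfolding map_le_def by (metis asc_Some domD)

text \<open>The concepts are fixed by the hull alone; the generic chain decides only their
  values.\<close>

definition K :: "nat \<Rightarrow> conc set" where
  "K n = NC \<inter> Pow (tuples UNIV n)"

definition M :: "nat henkin_structure" where
  "M = Str K (the \<circ> asc)"

lemma M_simps [simp]: "Obj M = UNIV" "Conc M = K" "ext M = the \<circ> asc" "less_obj M = (<)"
  by (simp_all add: M_def)

lemma extends_assoc_M: "extends_assoc M (p k)"
  using p_le_asc[of k] by (auto simp: extends_assoc_def map_le_def)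

lemma cov_K:
  assumes "R \<in> K n" "n \<ge> 1"
  shows "\<exists>l\<ge>k. R \<in> Cov (p l) n"
proof -
  obtain l where "R \<in> Cov (p l) n" using meets_cov[of R n] assms by (auto simp: K_def D_cov_def)
  then have "R \<in> Cov (p (max k l)) n" using Cov_mono[OF p_le[of l "max k l"]] by auto
  then show ?thesis by (intro exI[of _ "max k l"]) simp
qed

lemma empty_K: "{} \<in> K n"
  using empty_NC by (simp add: K_def)

definition K_assign :: "nat cassign \<Rightarrow> bool" where
  "K_assign E \<longleftrightarrow> (\<forall>n\<ge>1. \<forall>i. E n i \<in> K n)"

lemma reduce_params:
  assumes "K_assign E"
  obtains es Rs where "set Rs \<subseteq> NC" "K_assign (conc_params Rs)"
    "agree k e (obj_params es) E (conc_params Rs)"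
proof -
  obtain es Rs where *: "agree k e (obj_params es) E (conc_params Rs)"
    "\<And>n i. n \<ge> 1 \<Longrightarrow> conc_params Rs n i = E n i \<or> conc_params Rs n i = {}"
    "set Rs \<subseteq> insert {} {E n i |n i. n \<ge> 1}"
    by (rule finite_params[of k e E]) (rule that)
  have "set Rs \<subseteq> NC" using *(3) assms empty_NC by (auto simp: K_assign_def K_def)
  moreover have "K_assign (conc_params Rs)"
    unfolding K_assign_def
  proof (intro allI impI)
    fix n i :: nat assume n: "1 \<le> n"
    show "conc_params Rs n i \<in> K n"
      using *(2)[OF n, of i] assms empty_K[of n] n by (auto simp: K_assign_def)
  qed
  ultimately show ?thesis using *(1) by (rule that)
qed

lemma K_assign_tuples: "K_assign E \<Longrightarrow> n \<ge> 1 \<Longrightarrow> E n i \<subseteq> tuples UNIV n"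
  by (auto simp: K_assign_def K_def)

lemma cov_params:
  assumes "set Rs \<subseteq> NC" "K_assign (conc_params Rs)"
  shows "\<exists>k. cov_assign (p k) (conc_params Rs)"
proof -
  \<comment> \<open>A trivially true formula is used for the clause \<open>cov_assign\<close> in
    \<open>D_choice\<close>: one condition then covers all parameters at once.\<close>
  have "\<exists>k. G k \<in> D_choice (EqO (OVar 0) (OVar 0)) [] 1 0 (obj_params []) (conc_params Rs)"
    using assms by (intro meets_choice K_assign_tuples sigma11.intros) auto
  then show ?thesis by (auto simp: D_choice_def)
qed

lemma K_assign_upd: "K_assign E \<Longrightarrow> X \<in> K n \<Longrightarrow> K_assign (upd_conc E n i X)"
  by (auto simp: K_assign_def upd_conc_def)

text \<open>\<open>sigma11_upward\<close> does not apply, since covered concepts may lie outside the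
  model. Each witness is first replaced through \<open>skolem_NC\<close>, after the parameters have
  been reduced to finite lists.\<close>

lemma sigma11_true:
  assumes "sigma11 \<phi>" "wf_form \<phi>" "K_assign E" "cov_assign (p k) E" "sat (PStr (p k)) e E \<phi>"
  shows "sat M e E \<phi>"
  using assms
proof (induction arbitrary: E)
  case (1 \<phi>)
  then show ?case using absolute_first_order[OF extends_assoc_M] by blast
next
  case (2 \<phi> n i)
  from 2 have wf: "wf_form \<phi>" "n \<ge> 1" by auto
  from 2 obtain X where X: "X \<in> Cov (p k) n" "sat (PStr (p k)) e (upd_conc E n i X) \<phi>" by auto
  obtain es Rs where Rs: "set Rs \<subseteq> NC" "K_assign (conc_params Rs)"
      "agree (fbound \<phi>) e (obj_params es) E (conc_params Rs)"
    by (rule reduce_params[OF \<open>K_assign E\<close>, of "fbound \<phi>" e]) (rule that)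
  have eq: "sat (PStr (p k)) e (upd_conc E n i X) \<phi> \<longleftrightarrow>
      sat (PStr (p k)) (obj_params es) (upd_conc (conc_params Rs) n i X) \<phi>" for X
    using wf(1) agree_upd(2)[OF Rs(3)] by (rule coincidence) simp
  obtain Y where Y: "Y \<in> NC" "Y \<in> Cov (p k) n"
      "sat (PStr (p k)) (obj_params es) (upd_conc (conc_params Rs) n i Y) \<phi>"
    using skolem_NC[OF G_NP Rs(1) X(1)] X(2) eq by blast
  have YK: "Y \<in> K n" using Y by (auto simp: K_def Cov_def)
  have "sat M e (upd_conc E n i Y) \<phi>"
    using "2.IH"[OF wf(1) K_assign_upd[OF 2(4) YK] cov_assign_upd[OF 2(5) Y(2)]] Y(3) eq by blast
  then show ?case using YK by auto
qed

text \<open>The opposite direction, at the price of a later stage: every concept of the model is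
  eventually covered.\<close>

lemma sigma11_in_chain:
  assumes "sigma11 \<phi>" "wf_form \<phi>" "cov_assign (p k) E" "sat M e E \<phi>"
  shows "\<exists>l\<ge>k. sat (PStr (p l)) e E \<phi>"
  using assms
proof (induction arbitrary: E k)
  case (1 \<phi>)
  then show ?case using absolute_first_order[OF extends_assoc_M] by blast
next
  case (2 \<phi> n i)
  from 2 have wf: "wf_form \<phi>" "n \<ge> 1" by auto
  from 2 obtain X where X: "X \<in> K n" "sat M e (upd_conc E n i X) \<phi>" by auto
  obtain k' where k': "k \<le> k'" "X \<in> Cov (p k') n" using cov_K[OF X(1) wf(2)] by blast
  have "cov_assign (p k') (upd_conc E n i X)"
    using cov_assign_mono[OF 2(4) p_le[OF k'(1)]] k'(2) by (rule cov_assign_upd)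
  then obtain l where l: "k' \<le> l" "sat (PStr (p l)) e (upd_conc E n i X) \<phi>"
    using "2.IH"[OF wf(1) _ X(2)] by blast
  then have "X \<in> Cov (p l) n" using k'(2) Cov_mono[OF p_le] by blast
  then show ?case using l k'(1) by (intro exI[of _ l]) auto
qed

section \<open>The axioms of the theory in the generic model\<close>

lemma assignment_M: "assignment M e E \<longleftrightarrow> K_assign E"
  by (simp add: assignment_def K_assign_def)

lemma M_henkin: "is_henkin_structure M"
  unfolding is_henkin_structure_def
proof (intro conjI allI impI ballI)
  show "section_at R as \<in> Conc M m" if "n \<ge> 1" "m \<ge> 1" "R \<in> Conc M (n + m)" "as \<in> tuples (Obj M) n" for n m R as
    using that section_NC[of R as] section_at_tuples[of R UNIV "n + m" as]
    by (simp add: K_def tuples_UNIV)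
qed (use empty_K in \<open>auto simp: K_def\<close>)

lemma K_dom_asc: "X \<in> K 1 \<Longrightarrow> X \<in> dom asc"
proof -
  assume "X \<in> K 1"
  then obtain l where "X \<in> Cov (p l) 1" using cov_K[of X 1 0] by auto
  then obtain n where "p l X = Some n" using Cov_1_dom by blast
  then have "asc X = Some n" unfolding asc_Some ..
  then show "X \<in> dom asc" by blast
qed

lemma asc_inj: "asc X = Some n \<Longrightarrow> asc Y = Some n \<Longrightarrow> X = Y"
proof -
  assume "asc X = Some n" "asc Y = Some n"
  then obtain k l where "p k X = Some n" "p l Y = Some n" by (auto simp: asc_Some)
  then have "p (max k l) X = Some n" "p (max k l) Y = Some n"
    using map_leD[OF p_le[OF max.cobounded1]] map_leD[OF p_le[OF max.cobounded2]] by blast+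
  then show "X = Y" by (rule assoc_inj[OF G_cond])
qed

lemma asc_K: "asc X = Some n \<Longrightarrow> X \<in> K 1"
proof -
  assume "asc X = Some n"
  then obtain k where k: "p k X = Some n" by (auto simp: asc_Some)
  then have "X \<in> NC" using pre_NC G_NP by blast
  moreover have "X \<subseteq> tuples UNIV 1" using G_cond[of k] k unfolding is_cond_def by blast
  ultimately show "X \<in> K 1" by (simp add: K_def)
qed

lemma M_law_V: "basic_law_V M"
  unfolding basic_law_V_def
proof (intro ballI iffI)
  fix X Y assume "X \<in> Conc M 1" "Y \<in> Conc M 1" "ext M X = ext M Y"
  moreover from this obtain m n where "asc X = Some m" "asc Y = Some n"
    using K_dom_asc by (metis M_simps(2) domD)
  ultimately show "X = Y" using asc_inj by simp
qed simp

lemma M_comprehension: "first_order_comprehension M"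
  unfolding first_order_comprehension_def
proof (intro allI impI)
  fix \<phi> :: form and xs :: "nat list" and e E
  assume "wf_form \<phi> \<and> first_order \<phi> \<and> distinct xs \<and> length xs \<ge> 1 \<and> assignment M e E"
  then have \<phi>: "wf_form \<phi>" "first_order \<phi>" and E: "K_assign E" by (simp_all add: assignment_M)
  obtain es Rs where Rs: "set Rs \<subseteq> NC" "K_assign (conc_params Rs)"
      "agree (fbound \<phi>) e (obj_params es) E (conc_params Rs)"
    by (rule reduce_params[OF E, of "fbound \<phi>" e]) (rule that)
  obtain k where k: "cov_assign (p k) (conc_params Rs)" using cov_params[OF Rs(1,2)] by blast
  \<comment> \<open>Truth is evaluated under the condition \<open>G k\<close>, a member of the hull;
    this puts \<open>R\<close> into the hull, while absoluteness equates it with truth in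
    \<open>M\<close>.\<close>
  define R where "R = {as \<in> tuples UNIV (length xs).
    sat (PStr (p k)) (upd_tuple (obj_params es) xs as) (conc_params Rs) \<phi>}"
  have "R \<in> NC" unfolding R_def by (rule comp_NC[OF G_NP Rs(1)])
  then have "R \<in> Conc M (length xs)" by (auto simp: K_def R_def)
  moreover have "as \<in> R \<longleftrightarrow> sat M (upd_tuple e xs as) E \<phi>" if "as \<in> tuples (Obj M) (length xs)" for as
    using that absolute_first_order[OF extends_assoc_M k \<phi>]
      coincidence[OF \<phi>(1) agree_upd_tuple[OF Rs(3)] order_refl] by (simp add: R_def)
  ultimately show "\<exists>R\<in>Conc M (length xs). \<forall>as\<in>tuples (Obj M) (length xs).
      as \<in> R \<longleftrightarrow> sat M (upd_tuple e xs as) E \<phi>" by blast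
qed

text \<open>The chain meets \<open>D_choice\<close>. Its first alternative fails, because a witness
  in \<open>M\<close> for the excluded tuple would show up under a later condition of the chain. The
  second one provides \<open>R\<close>, which \<open>chosen_NC\<close> moves into the hull.\<close>

lemma M_choice: "sigma11_choice M"
  unfolding sigma11_choice_def
proof (intro allI impI)
  fix \<phi> :: form and xs :: "nat list" and m i :: nat and e E
  assume a: "wf_form \<phi> \<and> sigma11 \<phi> \<and> distinct xs \<and> length xs \<ge> 1 \<and> m \<ge> 1 \<and> assignment M e E"
    and ex: "\<forall>as\<in>tuples (Obj M) (length xs). \<exists>X\<in>Conc M m.
           sat M (upd_tuple e xs as) (upd_conc E m i X) \<phi>"
  from a have \<phi>: "wf_form \<phi>" "sigma11 \<phi>" and m: "m \<ge> 1" and E: "K_assign E"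
    by (simp_all add: assignment_M)
  obtain es Rs where Rs: "set Rs \<subseteq> NC" "K_assign (conc_params Rs)"
      "agree (fbound \<phi>) e (obj_params es) E (conc_params Rs)"
    by (rule reduce_params[OF E, of "fbound \<phi>" e]) (rule that)
  have eq: "sat M (upd_tuple e xs as) (upd_conc E m i X) \<phi> \<longleftrightarrow>
      sat M (upd_tuple (obj_params es) xs as) (upd_conc (conc_params Rs) m i X) \<phi>" for as X
    using \<phi>(1) agree_upd(2)[OF agree_upd_tuple[OF Rs(3)]] by (rule coincidence) simp
  have "\<exists>k. G k \<in> D_choice \<phi> xs m i (obj_params es) (conc_params Rs)"
    by (rule meets_choice[OF Rs(1) \<phi> m K_assign_tuples[OF Rs(2)]])
  then obtain k where k: "G k \<in> D_choice \<phi> xs m i (obj_params es) (conc_params Rs)" ..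
  then have cov: "cov_assign (p k) (conc_params Rs)" by (simp add: D_choice_def)
  have "\<exists>R\<in>Cov (p k) (length xs + m). \<forall>as\<in>tuples UNIV (length xs).
      sat (PStr (p k)) (upd_tuple (obj_params es) xs as) (upd_conc (conc_params Rs) m i (section_at R as)) \<phi>"
  proof (rule ccontr)
    assume "\<not> ?thesis"
    then obtain as where as: "as \<in> tuples UNIV (length xs)"
      and no: "\<And>r X. is_cond r \<Longrightarrow> r \<unlhd> G k \<Longrightarrow> X \<in> Cov (fst r) m \<Longrightarrow>
        \<not> sat (PStr (fst r)) (upd_tuple (obj_params es) xs as) (upd_conc (conc_params Rs) m i X) \<phi>"
      using k unfolding D_choice_def mem_Collect_eq by blast
    obtain X where X: "X \<in> K m"
        "sat M (upd_tuple (obj_params es) xs as) (upd_conc (conc_params Rs) m i X) \<phi>"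
      using ex as eq by auto
    obtain k' where k': "k \<le> k'" "X \<in> Cov (p k') m" using cov_K[OF X(1) m] by blast
    have "cov_assign (p k') (upd_conc (conc_params Rs) m i X)"
      using cov_assign_mono[OF cov p_le[OF k'(1)]] k'(2) by (rule cov_assign_upd)
    then obtain l where l: "k' \<le> l"
        "sat (PStr (p l)) (upd_tuple (obj_params es) xs as) (upd_conc (conc_params Rs) m i X) \<phi>"
      using sigma11_in_chain[OF \<phi>(2,1) _ X(2)] by blast
    have "X \<in> Cov (p l) m" using k'(2) Cov_mono[OF p_le[OF l(1)]] by blast
    moreover have "G l \<unlhd> G k" using k'(1) l(1) by (intro G_le) simp
    ultimately show False using no[OF G_cond] l(2) by blast
  qed
  then obtain R where R: "R \<in> NC" "R \<in> Cov (p k) (length xs + m)"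
      "\<forall>as\<in>tuples UNIV (length xs). sat (PStr (p k)) (upd_tuple (obj_params es) xs as)
        (upd_conc (conc_params Rs) m i (section_at R as)) \<phi>"
    using chosen_NC[OF G_NP Rs(1)] by blast
  have "sat M (upd_tuple e xs as) (upd_conc E m i (section_at R as)) \<phi>"
    if as: "as \<in> tuples (Obj M) (length xs)" for as
  proof -
    have C: "section_at R as \<in> Cov (p k) m"
      using Cov_section[OF R(2), of as] as m by (simp add: tuples_UNIV)
    then have "section_at R as \<in> K m" using section_NC[OF R(1)] by (auto simp: K_def Cov_def)
    then show ?thesis unfolding eq
      using sigma11_true[OF \<phi>(2,1) K_assign_upd[OF Rs(2)] cov_assign_upd[OF cov C]] R(3) as by auto
  qed
  moreover have "R \<in> Conc M (length xs + m)" using R(1,2) by (auto simp: K_def Cov_def)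
  ultimately show "\<exists>R\<in>Conc M (length xs + m). \<forall>as\<in>tuples (Obj M) (length xs).
      sat M (upd_tuple e xs as) (upd_conc E m i (section_at R as)) \<phi>" by blast
qed

lemma M_least: "least_element_schema M"
  unfolding least_element_schema_def
proof (intro allI impI)
  fix \<phi> :: form and x :: nat and e E
  assume "\<exists>a\<in>Obj M. sat M (e(x := a)) E \<phi>"
  then have "\<exists>a. sat M (e(x := a)) E \<phi> \<and> (\<forall>b<a. \<not> sat M (e(x := b)) E \<phi>)"
    using exists_least_iff[of "\<lambda>a. sat M (e(x := a)) E \<phi>"] by auto
  then show "\<exists>a\<in>Obj M. sat M (e(x := a)) E \<phi> \<and>
      (\<forall>b\<in>Obj M. less_obj M b a \<longrightarrow> \<not> sat M (e(x := b)) E \<phi>)" by auto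
qed

lemma M_model: "model_sigma11_LB_GC M"
  unfolding model_sigma11_LB_GC_def
  using M_henkin M_law_V M_comprehension M_choice M_least by (auto simp: linear_order_obj_def)

subsection \<open>The well-founded extensions of the generic model\<close>

lemma ran_asc: "y \<in> ran asc \<longleftrightarrow> (\<exists>k. y \<in> ran (p k))"
  by (auto simp: ran_def asc_Some)

lemma eta_M: "eta M a b \<longleftrightarrow> mem_in asc a b"
proof
  assume "eta M a b"
  then obtain X where X: "X \<in> K 1" "the (asc X) = b" "[a] \<in> X" by (auto simp: eta_def)
  then show "mem_in asc a b" using K_dom_asc[OF X(1)] by (auto simp: mem_in_def)
next
  assume "mem_in asc a b"
  then obtain X where "asc X = Some b" "[a] \<in> X" by (auto simp: mem_in_def)
  then show "eta M a b" unfolding eta_def using asc_K by (intro bexI[of _ X]) auto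
qed

lemma extensions_M: "extensions M = ran asc"
proof
  show "extensions M \<subseteq> ran asc"
    using K_dom_asc by (auto simp: extensions_def ran_def dom_def)
  show "ran asc \<subseteq> extensions M"
  proof
    fix x assume "x \<in> ran asc"
    then obtain X where "asc X = Some x" by (auto simp: ran_def)
    then show "x \<in> extensions M" unfolding extensions_def using asc_K
      by (intro image_eqI[of _ _ X]) auto
  qed
qed

text \<open>The members of a number are settled once it enters the range, because by injectivity
  only one concept ever has this value.\<close>

lemma mem_in_asc:
  assumes "y \<in> ran (p k)"
  shows "mem_in asc z y \<longleftrightarrow> mem_in (p k) z y"
proof -
  obtain X where X: "p k X = Some y" using assms by (auto simp: ran_def)
  then have "asc X = Some y" using asc_Some by blast
  then have "mem_in asc z y \<longleftrightarrow> [z] \<in> X" unfolding mem_in_def using asc_inj by blast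
  also have "\<dots> \<longleftrightarrow> mem_in (p k) z y" unfolding mem_in_def using X assoc_inj[OF G_cond X] by blast
  finally show ?thesis .
qed

lemma trcl_in_mono: "trcl_in (p k) x \<subseteq> trcl_in asc x"
  unfolding trcl_in_def using mem_in_mono[OF _ p_le_asc] by (auto elim!: rtranclp_mono[THEN predicate2D, rotated] intro!: predicate2I)

text \<open>Once all elements of the closure have values, their members are final and nothing can be
  added.\<close>

lemma trcl_in_asc:
  assumes "trcl_in (p k) x \<subseteq> ran (p k)"
  shows "trcl_in asc x = trcl_in (p k) x"
proof
  show "trcl_in asc x \<subseteq> trcl_in (p k) x"
  proof
    fix y assume "y \<in> trcl_in asc x"
    then have "(mem_in asc)\<^sup>*\<^sup>* y x" by (simp add: trcl_in_def)
    then show "y \<in> trcl_in (p k) x"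
    proof (induction rule: converse_rtranclp_induct)
      case (step y z)
      have "z \<in> ran (p k)" using step.IH assms by blast
      then have "mem_in (p k) y z" using step.hyps(1) by (simp add: mem_in_asc)
      with step.IH show ?case by (rule trcl_in_step)
    qed (rule trcl_in_refl)
  qed
qed (rule trcl_in_mono)

lemma forbidden_asc: "y \<in> snd (G k) \<Longrightarrow> y \<notin> ran asc"
proof
  assume y: "y \<in> snd (G k)" "y \<in> ran asc"
  then obtain l where l: "y \<in> ran (p l)" by (auto simp: ran_asc)
  have "y \<in> ran (p (max k l))" using l p_le[of l "max k l"] by (auto simp: ran_def dest: map_leD)
  moreover have "y \<in> snd (G (max k l))" using y(1) G_le[of k "max k l"] by (auto simp: extends_def)
  ultimately show False using G_cond[of "max k l"] by (auto simp: is_cond_def)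
qed

lemma K1_eqI:
  assumes "X \<in> K 1" "Y \<in> K 1" "\<And>z. [z] \<in> X \<longleftrightarrow> [z] \<in> Y"
  shows "X = Y"
proof -
  have "Z \<subseteq> Z'" if Z: "Z \<in> K 1" "\<And>z. [z] \<in> Z \<Longrightarrow> [z] \<in> Z'" for Z Z'
  proof
    fix as assume as: "as \<in> Z"
    then have "length as = 1" using Z(1) by (auto simp: K_def tuples_UNIV)
    then obtain z where "as = [z]" by (auto simp: length_Suc_conv)
    then show "as \<in> Z'" using Z(2) as by simp
  qed
  then show ?thesis using assms by (intro equalityI) auto
qed

lemma sigma_M:
  assumes "x \<in> ran asc"
  shows "\<exists>S\<in>K 1. sigma M x = the (asc S) \<and> (\<forall>z. [z] \<in> S \<longleftrightarrow> mem_in asc z x \<or> z = x)"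
proof -
  obtain F where F: "asc F = Some x" using assms by (auto simp: ran_def)
  then have FK: "F \<in> K 1" by (rule asc_K)
  \<comment> \<open>The disjunction \<open>[z] \<in> F \<or> z = x\<close>. All object variables are
    assigned \<open>x\<close> and only variable 0 is updated, so \<open>OVar 1\<close> denotes
    \<open>x\<close>.\<close>
  define \<phi> where "\<phi> = Neg (Conj (Neg (Pred (CVar 1 0) [OVar 0])) (Neg (EqO (OVar 0) (OVar 1))))"
  define E where "E = (\<lambda>(n::nat) i. if n = 1 \<and> i = (0::nat) then F else {})"
  have "assignment M (\<lambda>_. x) E" using FK empty_K by (auto simp: assignment_M K_assign_def E_def)
  moreover have "wf_form \<phi>" "first_order \<phi>" by (simp_all add: \<phi>_def)
  ultimately have "\<exists>S\<in>K 1. \<forall>as\<in>tuples UNIV 1. as \<in> S \<longleftrightarrow> sat M (upd_tuple (\<lambda>_. x) [0] as) E \<phi>"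
    using M_comprehension[unfolded first_order_comprehension_def, rule_format, of \<phi> "[0]" "\<lambda>_. x" E]
    by simp
  then obtain S where S: "S \<in> K 1" "\<And>z. [z] \<in> S \<longleftrightarrow> [z] \<in> F \<or> z = x"
    by (auto simp: tuples_UNIV \<phi>_def upd_tuple_def E_def)
  have mem: "mem_in asc z x \<longleftrightarrow> [z] \<in> F" for z
    unfolding mem_in_def using F asc_inj by blast
  have "sigma M x = the (asc S)"
    unfolding sigma_def
  proof (rule the_equality)
    show "\<exists>F\<in>Conc M 1. \<exists>G\<in>Conc M 1. x = ext M F \<and> the (asc S) = ext M G \<and>
        (\<forall>z\<in>Obj M. [z] \<in> G \<longleftrightarrow> [z] \<in> F \<or> z = x)"
      using F FK S by (intro bexI[of _ F] bexI[of _ S]) auto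
  next
    fix y assume "\<exists>F\<in>Conc M 1. \<exists>G\<in>Conc M 1. x = ext M F \<and> y = ext M G \<and>
        (\<forall>z\<in>Obj M. [z] \<in> G \<longleftrightarrow> [z] \<in> F \<or> z = x)"
    then obtain F' S' where F': "F' \<in> K 1" "S' \<in> K 1" "x = the (asc F')" "y = the (asc S')"
      "\<And>z. [z] \<in> S' \<longleftrightarrow> [z] \<in> F' \<or> z = x" by auto
    have "asc F' = Some x" using K_dom_asc[OF F'(1)] F'(3) by auto
    then have "F' = F" using F by (rule asc_inj)
    then have "S' = S" using F' S by (intro K1_eqI) auto
    then show "y = the (asc S)" using F'(4) by simp
  qed
  then show ?thesis using S mem by blast
qed

lemma eta_ext:
  assumes "F \<in> K 1"
  shows "eta M c (the (asc F)) \<longleftrightarrow> [c] \<in> F"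
proof -
  obtain n where "asc F = Some n" using K_dom_asc[OF assms] by blast
  then show ?thesis unfolding eta_M mem_in_def using asc_inj by auto
qed

text \<open>Inclusion of \<open>sigma M x\<close> in a concept means that it holds of
  \<open>x\<close> and of the members of \<open>x\<close>; for a transitive concept the former
  suffices.\<close>

lemma trcl_eta_M:
  assumes "x \<in> ran asc"
  shows "trcl_eta M (sigma M x) =
    {y. \<forall>F\<in>K 1. (\<forall>a b. [a] \<in> F \<and> mem_in asc b a \<longrightarrow> [b] \<in> F) \<and> [x] \<in> F \<longrightarrow> [y] \<in> F}"
proof -
  obtain S where S: "S \<in> K 1" "sigma M x = the (asc S)" "\<And>z. [z] \<in> S \<longleftrightarrow> mem_in asc z x \<or> z = x"
    using sigma_M[OF assms] by blast
  have "eta_transitive M F \<and> sub_eta M (sigma M x) (ext M F) \<longleftrightarrow>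
      (\<forall>a b. [a] \<in> F \<and> mem_in asc b a \<longrightarrow> [b] \<in> F) \<and> [x] \<in> F" if "F \<in> K 1" for F
    using eta_ext[OF S(1)] eta_ext[OF that]
    by (auto simp: eta_transitive_def sub_eta_def S(2,3) eta_M)
  then show ?thesis by (auto simp: trcl_eta_def)
qed

text \<open>The true closure is contained in every transitive concept that holds of
  \<open>x\<close>. Equality requires the closure to be a concept itself, as in
  \<open>trcl_eta_eq\<close>.\<close>

lemma trcl_eta_supset:
  assumes "x \<in> ran asc"
  shows "trcl_in asc x \<subseteq> trcl_eta M (sigma M x)"
proof
  fix y assume "y \<in> trcl_in asc x"
  then have "(mem_in asc)\<^sup>*\<^sup>* y x" by (simp add: trcl_in_def)
  then show "y \<in> trcl_eta M (sigma M x)"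
    unfolding trcl_eta_M[OF assms]
    by (induction rule: converse_rtranclp_induct) blast+
qed

lemma unary_K: "unary S \<in> NC \<Longrightarrow> unary S \<in> K 1"
  by (auto simp: K_def unary_def tuples_UNIV)

lemma unary_iff [simp]: "[a] \<in> unary S \<longleftrightarrow> a \<in> S"
  by (auto simp: unary_def)

text \<open>A closure decided at stage \<open>k\<close> is computed from \<open>G k\<close> and is
  thus a concept, hence the least transitive one holding of \<open>x\<close>.\<close>

lemma trcl_eta_eq:
  assumes "x \<in> ran asc" and ran: "trcl_in (p k) x \<subseteq> ran (p k)"
  shows "trcl_eta M (sigma M x) = trcl_in (p k) x"
proof
  let ?F = "unary (trcl_in (p k) x)"
  have F: "?F \<in> K 1" by (rule unary_K[OF trcl_NC[OF G_NP]])
  have cl: "b \<in> trcl_in (p k) x" if "a \<in> trcl_in (p k) x" "mem_in asc b a" for a b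
    using that trcl_in_step[of a asc x b] by (simp add: trcl_in_asc[OF ran])
  show "trcl_eta M (sigma M x) \<subseteq> trcl_in (p k) x"
  proof
    fix y assume "y \<in> trcl_eta M (sigma M x)"
    then have "\<forall>F\<in>K 1. (\<forall>a b. [a] \<in> F \<and> mem_in asc b a \<longrightarrow> [b] \<in> F) \<and> [x] \<in> F \<longrightarrow> [y] \<in> F"
      unfolding trcl_eta_M[OF assms(1)] by (rule CollectD)
    from bspec[OF this F]
    have "(\<forall>a b. a \<in> trcl_in (p k) x \<and> mem_in asc b a \<longrightarrow> b \<in> trcl_in (p k) x) \<and>
        x \<in> trcl_in (p k) x \<longrightarrow> y \<in> trcl_in (p k) x"
      unfolding unary_iff .
    then show "y \<in> trcl_in (p k) x" using cl trcl_in_refl[of x "p k"] by meson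
  qed
  show "trcl_in (p k) x \<subseteq> trcl_eta M (sigma M x)"
    using trcl_eta_supset[OF assms(1)] by (simp add: trcl_in_asc[OF ran])
qed

text \<open>The forbidden alternative of \<open>D_trcl\<close> would put a non-extension into the
  closure. With the closure decided, \<open>nonwf_NC\<close> turns any true failure of
  well-foundedness into a concept, so the model's notion agrees with the true one and the collapse
  exists.\<close>

lemma wfExt_codes:
  assumes "x \<in> wfExt M"
  shows "\<exists>k h. codes (p k) h x"
proof -
  have x: "x \<in> ran asc" "eta_wellfounded M (trcl_eta M (sigma M x))"
      "trcl_eta M (sigma M x) \<subseteq> ran asc"
    using assms by (auto simp: wfExt_def extensions_M)
  obtain k where "G k \<in> D_trcl x" using meets_trcl by blast
  moreover have "trcl_in (p k) x \<inter> snd (G k) = {}"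
    using trcl_in_mono[of k x] trcl_eta_supset[OF x(1)] x(3) forbidden_asc[of _ k] by blast
  ultimately have ran: "trcl_in (p k) x \<subseteq> ran (p k)" by (auto simp: D_trcl_def)
  have "\<exists>h. codes (p k) h x"
  proof (rule ex_codes[OF G_cond ran], rule ccontr)
    fix S assume "S \<subseteq> trcl_in (p k) x" "S \<noteq> {}" "\<not> (\<exists>y\<in>S. \<forall>z\<in>S. \<not> mem_in (p k) z y)"
    then obtain S where S: "S \<subseteq> trcl_in (p k) x" "S \<noteq> {}" "\<forall>y\<in>S. \<exists>z\<in>S. mem_in (p k) z y"
        "unary S \<in> NC" using nonwf_NC[OF G_NP, of S k x] by blast
    have "unary S \<noteq> {}" using S(2) by (auto simp: unary_def)
    then obtain y where y: "y \<in> S" "\<not> (\<exists>z. z \<in> S \<and> mem_in asc z y)"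
      using x(2)[unfolded eta_wellfounded_def trcl_eta_eq[OF x(1) ran], rule_format, of "unary S"]
        unary_K[OF S(4)] S(1) by (auto simp: eta_M)
    then show False using S(3) mem_in_mono[OF _ p_le_asc] by blast
  qed
  then show ?thesis by blast
qed

lemma codes_ran: "codes q h x \<Longrightarrow> x \<in> ran q"
  by (auto elim: codes.cases simp: ran_def)

lemma codes_wfExt:
  assumes c: "codes (p k) h x"
  shows "x \<in> wfExt M"
proof -
  have x: "x \<in> ran asc" using codes_ran[OF c] ran_asc by blast
  have coded: "\<exists>h. codes (p k) h y" if "y \<in> trcl_in (p k) x" for y
    using codes_trcl_in[OF G_cond c that] .
  then have ran: "trcl_in (p k) x \<subseteq> ran (p k)" using codes_ran by blast
  note eq = trcl_eta_eq[OF x ran]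
  have "eta_wellfounded M (trcl_eta M (sigma M x))"
    unfolding eta_wellfounded_def eq
  proof (intro ballI impI)
    fix F assume F: "F \<in> Conc M 1" "F \<noteq> {} \<and> (\<forall>y\<in>Obj M. [y] \<in> F \<longrightarrow> y \<in> trcl_in (p k) x)"
    \<comment> \<open>A minimal element of \<open>F\<close> is found by passing to the coded sets,
      where membership is well-founded.\<close>
    define Q where "Q = {h. \<exists>y. [y] \<in> F \<and> codes (p k) h y}"
    obtain as where "as \<in> F" using F by blast
    moreover from this have "length as = 1" using F(1) by (auto simp: K_def tuples_UNIV)
    ultimately obtain a where a: "[a] \<in> F" by (auto simp: length_Suc_conv)
    then obtain h0 where "codes (p k) h0 a" using F(2) coded[of a] by auto
    then have "h0 \<in> Q" using a by (auto simp: Q_def)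
    then obtain h where h: "h \<in> Q" "\<And>z. z \<in> elems h \<Longrightarrow> z \<notin> Q"
      using wfE_min[OF wf_elems, of h0 Q] by auto
    then obtain y where y: "[y] \<in> F" "codes (p k) h y" by (auto simp: Q_def)
    have "\<not> eta M z y" if "[z] \<in> F" for z
    proof
      assume "eta M z y"
      then have "mem_in (p k) z y" using mem_in_asc[OF codes_ran[OF y(2)]] by (simp add: eta_M)
      then obtain h' where "h' \<in> elems h" "codes (p k) h' z"
        using codes_mem[OF G_cond y(2)] by blast
      then show False using h(2) that by (auto simp: Q_def)
    qed
    then show "\<exists>y\<in>Obj M. [y] \<in> F \<and> \<not> (\<exists>z\<in>Obj M. [z] \<in> F \<and> eta M z y)" using y(1) by auto
  qed
  moreover have "trcl_in (p k) x \<subseteq> ran asc" using ran ran_asc by blast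
  ultimately show ?thesis using x by (simp add: wfExt_def extensions_M eq)
qed

definition coded :: "nat \<Rightarrow> hc" where
  "coded x = (SOME h. \<exists>k. codes (p k) h x)"

lemma codes_unique:
  assumes "codes (p k) h x" "codes (p l) h' x"
  shows "h = h'"
  using codes_unique_set[OF G_cond codes_mono[OF assms(1) p_le[OF max.cobounded1[of k l]]]
      codes_mono[OF assms(2) p_le[OF max.cobounded2[of l k]]]] by simp

lemma coded_eq: "codes (p k) h x \<Longrightarrow> coded x = h"
  unfolding coded_def by (rule some_equality) (auto intro: codes_unique)

lemma codes_coded: "x \<in> wfExt M \<Longrightarrow> \<exists>k. codes (p k) (coded x) x"
  using wfExt_codes coded_eq by blast

text \<open>The collapse \<open>coded\<close> is an isomorphism onto \<open>NH\<close>: codes are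
  unique, and genericity gives a code to every set in \<open>NH\<close>.\<close>

lemma wfExt_model: "model_ZFC_minus_P (wfExt M) (eta M)"
proof -
  interpret hc_submodel NH by (rule hc_submodel)
  have both: "\<exists>k. codes (p k) (coded a) a \<and> codes (p k) (coded b) b"
    if ab: "a \<in> wfExt M" "b \<in> wfExt M" for a b
  proof -
    obtain k l where "codes (p k) (coded a) a" "codes (p l) (coded b) b"
      using codes_coded ab by blast
    then have "codes (p (max k l)) (coded a) a" "codes (p (max k l)) (coded b) b"
      by (auto intro: codes_mono[OF _ p_le])
    then show ?thesis by blast
  qed
  have "hc_copy NH (wfExt M) (eta M) coded"
  proof
    show "inj_on coded (wfExt M)"
    proof (rule inj_onI)
      fix a b assume "a \<in> wfExt M" "b \<in> wfExt M" "coded a = coded b"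
      then obtain k where "codes (p k) (coded a) a" "codes (p k) (coded a) b" using both[of a b] by auto
      then show "a = b" by (rule codes_unique_code)
    qed
    show "coded ` wfExt M = NH"
    proof
      show "coded ` wfExt M \<subseteq> NH" using codes_coded collapse_NH[OF G_NP] by blast
      show "NH \<subseteq> coded ` wfExt M"
      proof
        fix h assume "h \<in> NH"
        then obtain k n where "codes (p k) h n" using meets_code[of h] by (auto simp: D_code_def)
        then show "h \<in> coded ` wfExt M" using codes_wfExt coded_eq by blast
      qed
    qed
    show "eta M a b \<longleftrightarrow> coded a \<in> elems (coded b)" if ab: "a \<in> wfExt M" "b \<in> wfExt M" for a b
    proof -
      obtain k where k: "codes (p k) (coded a) a" "codes (p k) (coded b) b" using both[OF ab] by blast
      have "eta M a b \<longleftrightarrow> mem_in (p k) a b"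
        using mem_in_asc[OF codes_ran[OF k(2)]] by (simp add: eta_M)
      also have "\<dots> \<longleftrightarrow> (\<exists>x\<in>elems (coded b). codes (p k) x a)" by (rule codes_mem[OF G_cond k(2)])
      also have "\<dots> \<longleftrightarrow> coded a \<in> elems (coded b)" using k(1) codes_unique by blast
      finally show ?thesis .
    qed
  qed
  then show ?thesis by (rule hc_copy.model_ZFC_minus_P)
qed

end

theorem theorem2p9:
  "\<exists>M :: nat henkin_structure. model_sigma11_LB_GC M \<and> model_ZFC_minus_P (wfExt M) (eta M)"
proof -
  obtain N where "hull N" using hull_exists by blast
  then obtain G where "generic N G" using hull.generic_exists by blast
  then show ?thesis using generic.M_model generic.wfExt_model by blast
qed

end
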